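(* For every integer $n\ge 4$, the projective realization space $\mathcal{R}_{n,2}$ is rationally equivalent to the interior of a $\binom{n-1}{2}$-dimensional cube. In particular, $\mathcal{R}_{n,2}$ is homeomorphic to an open ball and hence contractible.
   Context: For integers $0<k<n$, $\Delta_{n,k}=\mathrm{conv}\{x\in\{0,1\}^n : x_1+\cdots+x_n=k\}$. For $2\le k\le n-2$ its facets are exactly the $2n$ faces $F_i=\Delta_{n,k}\cap\{x_i=0\}$ and $G_i=\Delta_{n,k}\cap\{x_i=1\}$, $i=1,\dots,n$. For a polytope $P\subset\mathbb{R}^{n-1}$ its homogenization is the cone $\hom(P)=\mathrm{cone}(\{1\}\times P)\subset\mathbb{R}^n$. A combinatorial $(n,k)$-hypersimplex is a polytope $P \subset \mathbb{R}^{n-1}$ with face lattice isomorphic to that of $\Delta_{n,k}$; it is given by $2n$ facet-defining linear inequalities $f_i\ge0$, $g_i\ge 0$, labelled so that under the isomorphism $F_i$ corresponds to the facet where $f_i=0$ and $G_i$ to the facet where $g_i=0$. The projective realization space $\mathcal{R}_{n,k}$ is the set of matrices $(g_1,\dots,g_n,f_1,\dots,f_n)\in\mathbb{R}^{n\times 2n}$ (with columns $g_i,f_i\in\mathbb{R}^n$) for which the cone $\{y\in\mathbb{R}^n : \langle g_i,y\rangle\ge 0,\ \langle f_i,y\rangle\ge0,\ i=1,\dots,n\}$ is combinatorially isomorphic to $\hom(\Delta_{n,k})$, with $g_i,f_i$ defining the facets corresponding to $G_i,F_i$, modulo the action of $\mathrm{GL}_n(\mathbb{R})\times(\mathbb{R}_{>0})^{2n}$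 (linear changes of coordinates on $\mathbb{R}^n$ and positive rescaling of each of the $2n$ columns), with the quotient topology. Thus points of $\mathcal{R}_{n,k}$ are combinatorial $(n,k)$-hypersimplices up to (admissible) projective transformation. Rationally equivalent means that there is a homeomorphism such that both it and its inverse are given by rational functions (in terms of matrix representatives). *)

theory Defs
  imports "HOL-Analysis.Analysis"
begin

section \<open>Hypersimplices and their homogenizations\<close>

text \<open>The ambient dimension $n$ is \<open>CARD('n)\<close>; coordinates are indexed by the type \<open>'n\<close>.\<close>

definition hypersimplex :: "nat \<Rightarrow> (real^'n) set" where
  "hypersimplex k = convex hull {x. (\<forall>i. x $ i \<in> {0, 1}) \<and> (\<Sum>i\<in>UNIV. x $ i) = real k}"

definition facet_F :: "nat \<Rightarrow> 'n \<Rightarrow> (real^'n) set" where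
  "facet_F k i = hypersimplex k \<inter> {x. x $ i = 0}"

definition facet_G :: "nat \<Rightarrow> 'n \<Rightarrow> (real^'n) set" where
  "facet_G k i = hypersimplex k \<inter> {x. x $ i = 1}"

text \<open>The hypersimplex is an $(n-1)$-dimensional polytope sitting in a hyperplane of $\mathbb{R}^n$,
  so its homogenization, formed here in $\mathbb{R} \times \mathbb{R}^n$, is an $n$-dimensional cone.
  Only the face lattice of this cone is used below.\<close>

definition homogenization :: "'a::real_vector set \<Rightarrow> (real \<times> 'a) set" where
  "homogenization P = convex_cone hull ({1} \<times> P)"

section \<open>Combinatorial isomorphism\<close>

text \<open>Faces in the sense of \<^const>\<open>face_of\<close> include the empty set. For cones this only adjoins one
  further bottom element below the lattice of nonempty faces, on both sides of the isomorphism.\<close>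

definition face_lattice :: "'a::real_vector set \<Rightarrow> 'a set set" where
  "face_lattice C = {F. F face_of C}"

definition face_lattice_iso ::
    "'a::real_vector set \<Rightarrow> 'b::real_vector set \<Rightarrow> ('a set \<Rightarrow> 'b set) \<Rightarrow> bool" where
  "face_lattice_iso C D \<phi> \<longleftrightarrow>
     bij_betw \<phi> (face_lattice C) (face_lattice D) \<and>
     (\<forall>F\<in>face_lattice C. \<forall>F'\<in>face_lattice C. F \<subseteq> F' \<longleftrightarrow> \<phi> F \<subseteq> \<phi> F')"

section \<open>The projective realization space\<close>

text \<open>An $n \times 2n$ matrix $(g_1,\dots,g_n,f_1,\dots,f_n)$ has its columns indexed by \<open>'n + 'n\<close>:
  the column \<open>Inl i\<close> is $g_i$ and the column \<open>Inr i\<close> is $f_i$.\<close>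

definition g_col :: "real^('n::finite+'n)^'n \<Rightarrow> 'n \<Rightarrow> real^'n" where
  "g_col M i = column (Inl i) M"

definition f_col :: "real^('n::finite+'n)^'n \<Rightarrow> 'n \<Rightarrow> real^'n" where
  "f_col M i = column (Inr i) M"

definition matrix_cone :: "real^('n::finite+'n)^'n \<Rightarrow> (real^'n) set" where
  "matrix_cone M = {y. \<forall>i. g_col M i \<bullet> y \<ge> 0 \<and> f_col M i \<bullet> y \<ge> 0}"

definition realizations :: "nat \<Rightarrow> (real^('n::finite+'n)^'n) set" where
  "realizations k = {M. \<exists>\<phi>.
     face_lattice_iso (homogenization (hypersimplex k :: (real^'n) set)) (matrix_cone M) \<phi> \<and>
     (\<forall>i. \<phi> (homogenization (facet_G k i)) = matrix_cone M \<inter> {y. g_col M i \<bullet> y = 0}) \<and>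
     (\<forall>i. \<phi> (homogenization (facet_F k i)) = matrix_cone M \<inter> {y. f_col M i \<bullet> y = 0})}"

text \<open>Orbit equivalence for $\mathrm{GL}_n(\mathbb{R}) \times (\mathbb{R}_{>0})^{2n}$: the matrix \<open>A\<close>
  acts by left multiplication, and column \<open>j\<close> is rescaled by \<open>c j\<close>.\<close>

definition projective_equiv :: "nat \<Rightarrow> (real^('n::finite+'n)^'n) rel" where
  "projective_equiv k = {(M, N). M \<in> realizations k \<and> N \<in> realizations k \<and>
     (\<exists>(A::real^'n^'n) c. invertible A \<and> (\<forall>j. c j > 0) \<and>
        (\<forall>j. column j N = c j *\<^sub>R (A *v column j M)))}"

definition quotient_topology :: "'a topology \<Rightarrow> 'a rel \<Rightarrow> 'a set topology" where
  "quotient_topology X r = topology (\<lambda>U. U \<subseteq> topspace X // r \<and>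
     openin X {x \<in> topspace X. r `` {x} \<in> U})"

lemma openin_quotient_topology:
  "openin (quotient_topology X r) U \<longleftrightarrow>
     U \<subseteq> topspace X // r \<and> openin X {x \<in> topspace X. r `` {x} \<in> U}"
proof -
  have "istopology (\<lambda>U. U \<subseteq> topspace X // r \<and> openin X {x \<in> topspace X. r `` {x} \<in> U})"
    (is "istopology ?L")
    unfolding istopology_def
  proof (intro conjI allI impI)
    fix S T assume "?L S" "?L T"
    moreover have "{x \<in> topspace X. r `` {x} \<in> S \<inter> T} =
        {x \<in> topspace X. r `` {x} \<in> S} \<inter> {x \<in> topspace X. r `` {x} \<in> T}"
      by blast
    ultimately show "S \<inter> T \<subseteq> topspace X // r" "openin X {x \<in> topspace X. r `` {x} \<in> S \<inter> T}"
      by auto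
  next
    fix K assume K: "\<forall>U\<in>K. ?L U"
    then show "\<Union>K \<subseteq> topspace X // r"
      by blast
    have "{x \<in> topspace X. r `` {x} \<in> \<Union>K} = (\<Union>U\<in>K. {x \<in> topspace X. r `` {x} \<in> U})"
      by blast
    with K show "openin X {x \<in> topspace X. r `` {x} \<in> \<Union>K}"
      by auto
  qed
  then show ?thesis
    by (simp add: quotient_topology_def)
qed

lemma topspace_quotient_topology: "topspace (quotient_topology X r) = topspace X // r"
proof
  show "topspace (quotient_topology X r) \<subseteq> topspace X // r"
    unfolding topspace_def[of "quotient_topology X r"] openin_quotient_topology by blast
  have "{x \<in> topspace X. r `` {x} \<in> topspace X // r} = topspace X"
    by (auto intro: quotientI)
  then have "openin (quotient_topology X r) (topspace X // r)"
    by (simp add: openin_quotient_topology)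
  then show "topspace X // r \<subseteq> topspace (quotient_topology X r)"
    by (rule openin_subset)
qed

lemma quotient_map_quotient_topology:
  "quotient_map X (quotient_topology X r) (\<lambda>x. r `` {x})"
  unfolding quotient_map_def topspace_quotient_topology openin_quotient_topology
  by (auto simp: quotient_def)

definition projective_realization_space :: "nat \<Rightarrow> (real^('n::finite+'n)^'n) set topology" where
  "projective_realization_space k =
     quotient_topology (top_of_set (realizations k)) (projective_equiv k)"

section \<open>Rational equivalence\<close>

text \<open>On a Euclidean space, \<^const>\<open>real_polynomial_function\<close> describes exactly the polynomials in the
  coordinates. The denominator of a rational map must not vanish anywhere on its domain.\<close>

definition rational_map_on :: "'a::euclidean_space set \<Rightarrow> ('a \<Rightarrow> 'b::euclidean_space) \<Rightarrow> bool" where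
  "rational_map_on S \<phi> \<longleftrightarrow> (\<forall>b\<in>Basis. \<exists>p q. real_polynomial_function p \<and> real_polynomial_function q \<and>
     (\<forall>x\<in>S. q x \<noteq> 0 \<and> \<phi> x \<bullet> b = p x / q x))"

text \<open>Rational equivalence of the quotient \<open>S // r\<close> with a subset \<open>T\<close> of a Euclidean space:
  the homeomorphism \<open>h\<close> is rational in any representative, and its inverse \<open>h'\<close> is given by
  choosing representatives rationally.\<close>

definition rationally_equivalent ::
    "'a::euclidean_space set \<Rightarrow> 'a rel \<Rightarrow> 'b::euclidean_space set \<Rightarrow> bool" where
  "rationally_equivalent S r T \<longleftrightarrow> (\<exists>h h'.
     homeomorphic_maps (quotient_topology (top_of_set S) r) (top_of_set T) h h' \<and>
     (\<exists>\<phi>. rational_map_on S \<phi> \<and> (\<forall>x\<in>S. h (r `` {x}) = \<phi> x)) \<and>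
     (\<exists>\<psi>. rational_map_on T \<psi> \<and> (\<forall>t\<in>T. \<psi> t \<in> S \<and> h' t = r `` {\<psi> t})))"

lemma equiv_projective_equiv:
  "equiv (realizations k :: (real^('n::finite+'n)^'n) set) (projective_equiv k)"
proof (rule equivI)
  show "projective_equiv k \<subseteq> realizations k \<times> (realizations k :: (real^('n+'n)^'n) set)"
    by (auto simp: projective_equiv_def)
  show "refl_on (realizations k :: (real^('n+'n)^'n) set) (projective_equiv k)"
  proof (rule refl_onI)
    fix M :: "real^('n+'n)^'n" assume "M \<in> realizations k"
    moreover have "invertible (mat 1 :: real^'n^'n)"
      by (simp add: invertible_def exI[of _ "mat 1"])
    ultimately show "(M, M) \<in> projective_equiv k"
      unfolding projective_equiv_def
      by (auto intro!: exI[of _ "mat 1"] exI[of _ "\<lambda>_. 1"])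
  qed
  show "sym (projective_equiv k :: (real^('n+'n)^'n) rel)"
  proof (rule symI)
    fix M N :: "real^('n+'n)^'n" assume "(M, N) \<in> projective_equiv k"
    then obtain A :: "real^'n^'n" and c where *: "M \<in> realizations k" "N \<in> realizations k"
      "invertible A" "\<And>j. c j > 0" "\<And>j. column j N = c j *\<^sub>R (A *v column j M)"
      unfolding projective_equiv_def by blast
    obtain B where B: "A ** B = mat 1" "B ** A = mat 1"
      using \<open>invertible A\<close> unfolding invertible_def by blast
    have "column j M = (1 / c j) *\<^sub>R (B *v column j N)" for j
      using *(4)[of j] B(2)
      by (simp add: *(5) matrix_vector_mult_scaleR matrix_vector_mul_assoc)
    moreover have "invertible B"
      using B unfolding invertible_def by blast
    moreover have "\<forall>j. 1 / c j > 0"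
      using *(4) by simp
    ultimately show "(N, M) \<in> projective_equiv k"
      unfolding projective_equiv_def using *(1,2)
      by (auto intro!: exI[of _ B] exI[of _ "\<lambda>j. 1 / c j"])
  qed
  show "trans (projective_equiv k :: (real^('n+'n)^'n) rel)"
  proof (rule transI)
    fix L M N :: "real^('n+'n)^'n"
    assume "(L, M) \<in> projective_equiv k" "(M, N) \<in> projective_equiv k"
    then obtain A B :: "real^'n^'n" and c d where *: "L \<in> realizations k" "N \<in> realizations k"
      "invertible A" "\<And>j. c j > 0" "\<And>j. column j M = c j *\<^sub>R (A *v column j L)"
      "invertible B" "\<And>j. d j > 0" "\<And>j. column j N = d j *\<^sub>R (B *v column j M)"
      unfolding projective_equiv_def by blast
    have "column j N = (d j * c j) *\<^sub>R ((B ** A) *v column j L)" for j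
      by (simp add: *(5,8) matrix_vector_mult_scaleR matrix_vector_mul_assoc)
    moreover have "invertible (B ** A)"
      using *(3,6) by (rule invertible_mult[rotated])
    moreover have "\<forall>j. d j * c j > 0"
      using *(4,7) by simp
    ultimately show "(L, N) \<in> projective_equiv k"
      unfolding projective_equiv_def using *(1,2)
      by (auto intro!: exI[of _ "B ** A"] exI[of _ "\<lambda>j. d j * c j"])
  qed
qed

end

theory Submission
  imports Defs
begin

text \<open>The face lattice of a polyhedral cone is encoded by the family of sets of constraints that are
  active at its points. Reading off this family at the points \<open>e\<^sub>i + e\<^sub>j\<close> shows that in a realization the
  \<open>f\<^sub>i\<close> form a basis, so that the \<open>g\<^sub>i\<close> truncate the vertices of the simplex \<open>f \<ge> 0\<close>, and that \<open>g\<^sub>i\<close> and \<open>g\<^sub>j\<close>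
  meet the edge \<open>i j\<close> in the same point. Conversely, the $\binom{n}{2}$ points on the edges can be chosen
  arbitrarily. Rescaling the \<open>f\<^sub>i\<close> moves the points on the \<open>n - 1\<close> edges through one vertex to a standard
  position, and each of the others then varies over an open interval.\<close>

section \<open>Face lattices and active constraints\<close>

text \<open>At the vertex for the pair i, j all f_l vanish except f_i and f_j, so a linear
  dependence among the f_l would change sign between any two indices; three indices rule this out.
  The converse is the harder half: edge points chosen at will must not disturb the face lattice. No
  list of faces is compared. Any two admissible matrices are shown to have the same family of active
  sets, and the hypersimplex itself is given by one of them. The key is a positive combination of
  g_i and g_j whose coefficients in the basis f are zero at i and j and positive elsewhere, so that
  on the simplex g_i and g_j vanish together only on the edge i j. Normalizing the n - 1 edges
  through one vertex leaves C(n,2) - (n-1) = C(n-1,2) parameters. Each is the product along a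
  3-cycle, a positive number that reversing the cycle inverts; \<tau> / (1 + \<tau>) carries it
  rationally into the unit interval. Determinants from Cramer's rule stand in for the coefficients
  of g_i, so that the invariants are visibly quotients of polynomials.\<close>

definition hcone :: "'a::real_vector set \<Rightarrow> ('m \<Rightarrow> 'a \<Rightarrow> real) \<Rightarrow> 'a set" where
  "hcone V h = {x\<in>V. \<forall>m. 0 \<le> h m x}"

definition active :: "('m \<Rightarrow> 'a \<Rightarrow> real) \<Rightarrow> 'a \<Rightarrow> 'm set" where
  "active h x = {m. h m x = 0}"

definition hface :: "'a::real_vector set \<Rightarrow> ('m \<Rightarrow> 'a \<Rightarrow> real) \<Rightarrow> 'm set \<Rightarrow> 'a set" where
  "hface V h S = {x \<in> hcone V h. S \<subseteq> active h x}"

text \<open>A nonnegative linear form that vanishes inside a segment vanishes at both of its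
  ends.\<close>

lemma hface_face_of:
  assumes "subspace V" "\<And>m. linear (h m)"
  shows "hface V h S face_of hcone V h"
  unfolding face_of_def
proof (intro conjI ballI impI)
  note [simp] = linear_add[OF assms(2)] linear_scale[OF assms(2)]
  show "hface V h S \<subseteq> hcone V h"
    by (auto simp: hface_def)
  show "convex (hface V h S)"
    unfolding convex_def hface_def hcone_def active_def
    using assms(1) by (auto simp: subspace_add subspace_scale subset_iff)
  fix a b x assume ab: "a \<in> hcone V h" "b \<in> hcone V h" and x: "x \<in> hface V h S"
    and "x \<in> open_segment a b"
  then obtain u where u: "0 < u" "u < 1" "x = (1 - u) *\<^sub>R a + u *\<^sub>R b"
    by (auto simp: in_segment)
  have "h m a = 0 \<and> h m b = 0" if "m \<in> S" for m
  proof -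
    have "(1 - u) * h m a + u * h m b = 0"
      using x that u(3) by (auto simp: hface_def active_def)
    moreover have "0 \<le> h m a" "0 \<le> h m b"
      using ab by (auto simp: hcone_def)
    ultimately show ?thesis
      using u by (simp add: add_nonneg_eq_0_iff)
  qed
  with ab show "a \<in> hface V h S" "b \<in> hface V h S"
    by (auto simp: hface_def active_def)
qed

text \<open>A midpoint has the intersection of the two active sets, so an active set of least
  cardinality in \<open>F\<close> is contained in every other one.\<close>

lemma convex_subset_hcone_least_active:
  fixes h :: "'m::finite \<Rightarrow> 'a::real_vector \<Rightarrow> real"
  assumes "\<And>m. linear (h m)" "convex F" "F \<subseteq> hcone V h" "F \<noteq> {}"
  obtains x where "x \<in> F" "\<And>y. y \<in> F \<Longrightarrow> active h x \<subseteq> active h y"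
proof -
  note [simp] = linear_add[OF assms(1)] linear_scale[OF assms(1)]
  obtain x where x: "x \<in> F" "\<And>y. y \<in> F \<Longrightarrow> card (active h x) \<le> card (active h y)"
    using ex_has_least_nat[of "\<lambda>x. x \<in> F" _ "\<lambda>x. card (active h x)"] assms(4) by blast
  have "active h x \<subseteq> active h y" if y: "y \<in> F" for y
  proof -
    let ?z = "(1/2) *\<^sub>R x + (1/2) *\<^sub>R y"
    have "?z \<in> F"
      using assms(2) x y by (intro convexD) auto
    moreover have "h m ?z = 0 \<longleftrightarrow> h m x = 0 \<and> h m y = 0" for m
    proof -
      have "0 \<le> h m x" "0 \<le> h m y"
        using x(1) y assms(3) by (auto simp: hcone_def)
      then show ?thesis
        by auto
    qed
    then have "active h ?z = active h x \<inter> active h y"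
      by (auto simp: active_def)
    ultimately have "card (active h x) \<le> card (active h x \<inter> active h y)"
      using x(2) by metis
    then show ?thesis
      by (metis card_seteq finite inf_le1 inf.absorb_iff1)
  qed
  with x(1) that show thesis
    by blast
qed

text \<open>If \<open>x\<close> has the fewest active constraints in the face and \<open>y\<close> satisfies these with equality,
  then the segment from \<open>y\<close> to \<open>x\<close> can be prolonged beyond \<open>x\<close> within the cone.\<close>

lemma face_of_hcone_cases:
  fixes h :: "'m::finite \<Rightarrow> 'a::real_vector \<Rightarrow> real"
  assumes "subspace V" "\<And>m. linear (h m)" "F face_of hcone V h" "F \<noteq> {}"
  obtains x where "x \<in> F" "F = hface V h (active h x)"
proof -
  note [simp] = linear_add[OF assms(2)] linear_scale[OF assms(2)] linear_diff[OF assms(2)]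
  have F: "F \<subseteq> hcone V h" "convex F"
    using assms(3) by (auto simp: face_of_def)
  obtain x where x: "x \<in> F" "\<And>y. y \<in> F \<Longrightarrow> active h x \<subseteq> active h y"
    using convex_subset_hcone_least_active[OF assms(2) F(2,1) assms(4)] by blast
  have "y \<in> F" if y: "y \<in> hface V h (active h x)" for y
  proof (cases "y = x")
    case False
    have pos: "\<forall>m\<in>- active h x. 0 < h m x" 
      using x(1) F(1) by (force simp: active_def hcone_def less_le)
    \<comment> \<open>Prolonging by \<open>e\<close> gives the value
      \<open>h m x + e * (h m x - h m y)\<close>. Constraints active at \<open>x\<close> are active
      at \<open>y\<close> as well, the others leave slack at \<open>x\<close>; being finitely many,
      they admit a common \<open>e\<close>.\<close>
    have "\<exists>e>0. \<forall>m. e * (h m y - h m x) \<le> h m x"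
    proof -
      have "\<exists>e. 0 < e \<and> e * (h m y - h m x) \<le> h m x" for m
      proof (cases "m \<in> active h x")
        case True
        then show ?thesis
          using y by (auto simp: hface_def active_def intro!: exI[of _ 1])
      next
        case m: False
        then have "0 < h m x"
          using pos by blast
        then show ?thesis
        proof (cases "h m y \<le> h m x")
          case True
          with \<open>0 < h m x\<close> show ?thesis
            by (intro exI[of _ 1]) auto
        next
          case False
          with \<open>0 < h m x\<close> show ?thesis
            by (intro exI[of _ "h m x / (h m y - h m x)"]) auto
        qed
      qed
      then obtain e where e: "\<And>m. 0 < e m \<and> e m * (h m y - h m x) \<le> h m x"
        by metis
      define e0 where "e0 = Min (range e)"
      have "0 < e0" "\<And>m. e0 \<le> e m"
        using e by (auto simp: e0_def)
      moreover have "e0 * (h m y - h m x) \<le> h m x" for m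
      proof (cases "h m y \<le> h m x")
        case True
        have "0 \<le> h m x" using x(1) F(1) by (auto simp: hcone_def)
        moreover have "e0 * (h m y - h m x) \<le> 0"
          using True \<open>0 < e0\<close> by (simp add: mult_nonneg_nonpos)
        ultimately show ?thesis by linarith
      next
        case False
        then have "e0 * (h m y - h m x) \<le> e m * (h m y - h m x)"
          using \<open>e0 \<le> e m\<close> by (intro mult_right_mono) auto
        with e[of m] show ?thesis by linarith
      qed
      ultimately show ?thesis by blast
    qed
    then obtain e where e: "e > 0" "\<And>m. e * (h m y - h m x) \<le> h m x"
      by blast
    define z where "z = x + e *\<^sub>R (x - y)"
    have "z \<in> hcone V h"
      using e assms(1) x(1) y F(1)
      by (auto simp: z_def hcone_def hface_def subset_iff algebra_simps
          intro!: subspace_add subspace_diff subspace_scale)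
    moreover have "x \<in> open_segment y z"
    proof -
      have "x = (1 - 1 / (1 + e)) *\<^sub>R y + (1 / (1 + e)) *\<^sub>R z"
      proof -
        have "(1 + e) *\<^sub>R x = e *\<^sub>R y + z"
          by (simp add: z_def algebra_simps)
        then have "(1 / (1 + e)) *\<^sub>R ((1 + e) *\<^sub>R x) = (1 / (1 + e)) *\<^sub>R (e *\<^sub>R y + z)"
          by simp
        moreover have "1 - 1 / (1 + e) = e / (1 + e)"
          using e(1) by (simp add: field_simps)
        ultimately show ?thesis
          using e(1) by (simp add: scaleR_add_right)
      qed
      moreover have "y \<noteq> z"
      proof
        assume "y = z"
        then have "(1 + e) *\<^sub>R (x - y) = 0"
          by (simp add: z_def algebra_simps)
        then show False
          using e(1) False by simp
      qed
      ultimately show ?thesis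
        using e(1) unfolding in_segment by (intro conjI exI[of _ "1 / (1 + e)"]) auto
    qed
    ultimately show ?thesis
      using assms(3) x(1) y unfolding face_of_def hface_def by blast
  qed (use x in simp)
  moreover have "F \<subseteq> hface V h (active h x)"
    using x F(1) by (auto simp: hface_def)
  ultimately show thesis
    using that x(1) by blast
qed

text \<open>Formulated through points instead of a chosen set of constraints: this makes it monotone
  by its very form.\<close>

definition transport :: "('m \<Rightarrow> 'a \<Rightarrow> real) \<Rightarrow> 'b::real_vector set \<Rightarrow> ('m \<Rightarrow> 'b \<Rightarrow> real) \<Rightarrow> 'a set \<Rightarrow> 'b set" where
  "transport h W k F = {y \<in> hcone W k. \<exists>x\<in>F. active h x \<subseteq> active k y}"

text \<open>The inclusion of the families supplies, for every point of the target face, a source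
  point with the same active set.\<close>

lemma transport_hface:
  assumes "active k ` hcone W k \<subseteq> active h ` hcone V h"
  shows "transport h W k (hface V h S) = hface W k S"
proof
  show "hface W k S \<subseteq> transport h W k (hface V h S)"
  proof
    fix y assume y: "y \<in> hface W k S"
    then have "active k y \<in> active h ` hcone V h"
      using assms by (auto simp: hface_def)
    then obtain x where "x \<in> hcone V h" "active h x = active k y"
      by auto
    with y show "y \<in> transport h W k (hface V h S)"
      by (auto simp: transport_def hface_def)
  qed
qed (auto simp: transport_def hface_def)

lemma transport_face:
  fixes h :: "'m::finite \<Rightarrow> 'a::real_vector \<Rightarrow> real" and k :: "'m \<Rightarrow> 'b::real_vector \<Rightarrow> real"
  assumes V: "subspace V" "\<And>m. linear (h m)" and W: "subspace W" "\<And>m. linear (k m)"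
    and eq: "active h ` hcone V h = active k ` hcone W k"
    and F: "F \<in> face_lattice (hcone V h)"
  shows "transport h W k F \<in> face_lattice (hcone W k)"
    and "transport k V h (transport h W k F) = F"
proof -
  have "transport h W k F \<in> face_lattice (hcone W k) \<and> transport k V h (transport h W k F) = F"
  proof (cases "F = {}")
    case True
    then have "transport h W k F = {}"
      by (simp add: transport_def)
    moreover have "transport k V h {} = {}"
      by (simp add: transport_def)
    ultimately show ?thesis
      using True by (simp add: face_lattice_def)
  next
    case False
    then obtain S where S: "F = hface V h S"
      using F face_of_hcone_cases[of V h F, OF V] unfolding face_lattice_def by blast
    have "transport h W k F = hface W k S"
      unfolding S using eq by (intro transport_hface) simp
    moreover have "transport k V h (hface W k S) = F"
      unfolding S using eq by (intro transport_hface) simp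
    ultimately show ?thesis
      using hface_face_of[OF W] by (simp add: face_lattice_def)
  qed
  then show "transport h W k F \<in> face_lattice (hcone W k)"
    and "transport k V h (transport h W k F) = F"
    by auto
qed

lemma face_lattice_iso_transport:
  fixes h :: "'m::finite \<Rightarrow> 'a::real_vector \<Rightarrow> real" and k :: "'m \<Rightarrow> 'b::real_vector \<Rightarrow> real"
  assumes V: "subspace V" "\<And>m. linear (h m)" and W: "subspace W" "\<And>m. linear (k m)"
    and eq: "active h ` hcone V h = active k ` hcone W k"
  shows "face_lattice_iso (hcone V h) (hcone W k) (transport h W k)"
proof -
  note into = transport_face(1)[OF V W eq] and inv = transport_face(2)[OF V W eq]
    and into' = transport_face(1)[OF W V eq[symmetric]] and inv' = transport_face(2)[OF W V eq[symmetric]]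
  have mono: "transport h W k F \<subseteq> transport h W k F'" if "F \<subseteq> F'" for F F'
    using that by (auto simp: transport_def)
  have mono': "transport k V h F \<subseteq> transport k V h F'" if "F \<subseteq> F'" for F F'
    using that by (auto simp: transport_def)
  have "bij_betw (transport h W k) (face_lattice (hcone V h)) (face_lattice (hcone W k))"
    by (rule bij_betw_byWitness[of _ "transport k V h"]) (simp_all add: inv inv' image_subset_iff into into')
  moreover have "F \<subseteq> F' \<longleftrightarrow> transport h W k F \<subseteq> transport h W k F'"
    if "F \<in> face_lattice (hcone V h)" "F' \<in> face_lattice (hcone V h)" for F F'
    using mono mono' inv that by metis
  ultimately show ?thesis
    by (simp add: face_lattice_iso_def)
qed

text \<open>An active set \<open>Z\<close> is visible in the lattice: it consists of those
  \<open>m\<close> whose face \<open>hface V h {m}\<close> contains \<open>hface V h Z\<close>. The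
  isomorphism preserves this, and the image face is itself given by the active set of one of its
  points.\<close>

lemma face_lattice_iso_active:
  fixes h :: "'m::finite \<Rightarrow> 'a::real_vector \<Rightarrow> real" and k :: "'m \<Rightarrow> 'b::real_vector \<Rightarrow> real"
  assumes V: "subspace V" "\<And>m. linear (h m)" and W: "subspace W" "\<And>m. linear (k m)"
    and iso: "face_lattice_iso (hcone V h) (hcone W k) \<phi>"
    and facets: "\<And>m. \<phi> (hface V h {m}) = hface W k {m}"
  shows "active h ` hcone V h \<subseteq> active k ` hcone W k"
proof
  fix Z assume "Z \<in> active h ` hcone V h"
  then obtain x where x: "x \<in> hcone V h" "Z = active h x"
    by blast
  have bij: "bij_betw \<phi> (face_lattice (hcone V h)) (face_lattice (hcone W k))"
    and mono: "\<And>F F'. F \<in> face_lattice (hcone V h) \<Longrightarrow> F' \<in> face_lattice (hcone V h) \<Longrightarrow>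
       F \<subseteq> F' \<longleftrightarrow> \<phi> F \<subseteq> \<phi> F'"
    using iso by (auto simp: face_lattice_iso_def)
  have hf: "hface V h S \<in> face_lattice (hcone V h)" for S
    using hface_face_of[OF V] by (simp add: face_lattice_def)
  let ?F = "hface V h Z"
  have "x \<in> ?F"
    using x by (simp add: hface_def)
  have empty: "{} \<in> face_lattice (hcone V h)" "{} \<in> face_lattice (hcone W k)"
    by (simp_all add: face_lattice_def)
  \<comment> \<open>The bottom element goes to the bottom element, so the image of a nonempty face
    is nonempty.\<close>
  have "\<phi> {} = {}"
  proof -
    obtain F where "F \<in> face_lattice (hcone V h)" "{} = \<phi> F"
      using bij empty(2) by (auto simp: bij_betw_def)
    then show ?thesis
      using mono[OF empty(1), of F] by auto
  qed
  then have "\<phi> ?F \<noteq> {}"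
    using \<open>x \<in> ?F\<close> mono[OF hf[of Z] empty(1)] by auto
  moreover have "\<phi> ?F face_of hcone W k"
    using bij_betwE[OF bij] hf[of Z] unfolding face_lattice_def by blast
  ultimately obtain y where y: "y \<in> \<phi> ?F" "\<phi> ?F = hface W k (active k y)"
    using face_of_hcone_cases[of W k "\<phi> ?F", OF W] by blast
  have "m \<in> Z \<longleftrightarrow> m \<in> active k y" for m
  proof -
    have "m \<in> Z \<longleftrightarrow> ?F \<subseteq> hface V h {m}"
      using \<open>x \<in> ?F\<close> x by (auto simp: hface_def)
    also have "\<dots> \<longleftrightarrow> \<phi> ?F \<subseteq> hface W k {m}"
      using mono[OF hf hf] facets by simp
    also have "\<dots> \<longleftrightarrow> m \<in> active k y"
      using y by (auto simp: hface_def)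
    finally show ?thesis .
  qed
  then have "Z = active k y"
    by blast
  moreover have "y \<in> hcone W k"
    using y by (auto simp: hface_def)
  ultimately show "Z \<in> active k ` hcone W k"
    by blast
qed

section \<open>The homogenized hypersimplex\<close>

text \<open>By Krein-Milman it suffices that the extreme points of the right-hand side are 0/1
  vectors. The sum is an integer, so a fractional coordinate never comes alone, and mass can be
  shifted both ways between two of them.\<close>

lemma hypersimplex_eq:
  "(hypersimplex k :: (real^'n) set) = {x. (\<forall>i. 0 \<le> x $ i \<and> x $ i \<le> 1) \<and> (\<Sum>i\<in>UNIV. x $ i) = real k}"
  (is "_ = ?P")
proof
  let ?W = "{x::real^'n. (\<forall>i. x $ i \<in> {0, 1}) \<and> (\<Sum>i\<in>UNIV. x $ i) = real k}"
  have "convex ?P"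
  proof (rule convexI)
    fix x y :: "real^'n" and u v :: real
    assume "x \<in> ?P" "y \<in> ?P" and uv: "0 \<le> u" "0 \<le> v" "u + v = 1"
    moreover have "(\<Sum>i\<in>UNIV. u * x $ i + v * y $ i) = u * (\<Sum>i\<in>UNIV. x $ i) + v * (\<Sum>i\<in>UNIV. y $ i)"
      by (simp add: sum.distrib sum_distrib_left)
    moreover have "u * real k + v * real k = real k"
      using uv by (simp flip: distrib_right)
    ultimately show "u *\<^sub>R x + v *\<^sub>R y \<in> ?P"
      by (auto intro: convex_bound_le)
  qed
  moreover have "?W \<subseteq> ?P"
    by (auto, metis less_eq_real_def zero_less_one, metis order_refl zero_le_one)
  ultimately show "hypersimplex k \<subseteq> ?P"
    unfolding hypersimplex_def by (rule hull_minimal[rotated])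
  have "closed ?P"
    by (intro closed_Collect_conj closed_Collect_all closed_Collect_le closed_Collect_eq
        continuous_intros)
  moreover have "?P \<subseteq> cbox 0 1"
    by (auto simp: mem_box_cart)
  ultimately have "compact ?P"
    by (meson bounded_cbox bounded_subset compact_eq_bounded_closed)
  moreover have "x \<in> ?W" if x: "x extreme_point_of ?P" for x
  proof -
    have xP: "x \<in> ?P"
      using x by (simp add: extreme_point_of_def)
    have "x $ i \<in> {0, 1}" for i
    proof (rule ccontr)
      assume i: "x $ i \<notin> {0, 1}"
      have "\<exists>j. j \<noteq> i \<and> x $ j \<notin> {0, 1}"
      proof (rule ccontr)
        assume "\<not> ?thesis"
        then have "(\<Sum>j\<in>UNIV - {i}. x $ j) \<in> \<int>"
          by (intro Ints_sum) (metis DiffE Ints_0 Ints_1 insertCI insertE singletonD)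
        moreover have "x $ i = real k - (\<Sum>j\<in>UNIV - {i}. x $ j)"
          using xP by (simp add: sum_diff1)
        ultimately have "x $ i \<in> \<int>"
          by simp
        moreover have "0 < x $ i" "x $ i < 1"
          using i xP by (auto simp: less_le)
        ultimately show False
          by (auto elim!: Ints_cases)
      qed
      then obtain j where j: "j \<noteq> i" "x $ j \<notin> {0, 1}"
        by blast
      \<comment> \<open>The largest shift that keeps both coordinates in the unit interval in either
        direction.\<close>
      define e where "e = Min {x $ i, 1 - x $ i, x $ j, 1 - x $ j}"
      have e: "0 < e" "e \<le> x $ i" "e \<le> 1 - x $ i" "e \<le> x $ j" "e \<le> 1 - x $ j"
        using i j xP by (auto simp: e_def less_le)
      define d :: "real^'n" where "d = axis i e - axis j e"
      have dn: "d $ l = (if l = i then e else if l = j then - e else 0)" for l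
        using j by (auto simp: d_def axis_def)
      have sd: "(\<Sum>l\<in>UNIV. d $ l) = 0"
        by (simp add: d_def sum_subtractf axis_def)
      have b: "0 \<le> x $ l" "x $ l \<le> 1" for l
        using xP by auto
      have "x + d \<in> ?P" "x - d \<in> ?P"
        using xP e sd b by (auto simp: sum.distrib sum_subtractf dn)
      moreover have "x \<in> open_segment (x + d) (x - d)"
      proof -
        have "(x + d) $ i \<noteq> (x - d) $ i"
          using e(1) dn[of i] by simp
        then have "x + d \<noteq> x - d"
          by metis
        then show ?thesis
          unfolding in_segment by (intro conjI exI[of _ "1/2"]) (auto simp: algebra_simps simp flip: scaleR_add_left)
      qed
      ultimately show False
        using x unfolding extreme_point_of_def by blast
    qed
    then show ?thesis
      using xP by blast
  qed
  ultimately show "?P \<subseteq> hypersimplex k"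
    unfolding hypersimplex_def using Krein_Milman_Minkowski[of ?P] \<open>convex ?P\<close>
    by (metis (no_types, lifting) hull_mono mem_Collect_eq subsetI)
qed

lemma homogenization_eq:
  assumes "convex P" "P \<noteq> {}"
  shows "homogenization P = {(t, t *\<^sub>R x) |t x. 0 \<le> t \<and> x \<in> P}"
proof -
  have "convex ({1::real} \<times> P)"
    using assms(1) by (intro convex_Times) auto
  then have "homogenization P = conic hull ({1} \<times> P)"
    unfolding homogenization_def using assms(2)
    by (subst convex_cone_hull_separate_nonempty) (simp_all add: hull_same)
  then show ?thesis
    by (auto simp: conic_hull_explicit) 
qed

text \<open>Homogenizations of 1 - x_i, which vanishes on G_i, and of x_i, which vanishes on F_i;
  the indexing matches the columns g_i and f_i.\<close>

definition hsimplex_form :: "'n + 'n \<Rightarrow> real \<times> (real^'n) \<Rightarrow> real" where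
  "hsimplex_form m y = (case m of Inl i \<Rightarrow> fst y - snd y $ i | Inr i \<Rightarrow> snd y $ i)"

text \<open>The linear hyperplane over the affine one that contains the hypersimplex; it is the
  reason why \<open>hcone\<close> carries an ambient subspace.\<close>

definition hsimplex_space :: "nat \<Rightarrow> (real \<times> (real^'n)) set" where
  "hsimplex_space k = {y. (\<Sum>i\<in>UNIV. snd y $ i) = real k * fst y}"

lemma subspace_hsimplex_space: "subspace (hsimplex_space k)"
  unfolding hsimplex_space_def subspace_def
  by (auto simp: sum.distrib algebra_simps simp flip: sum_distrib_left)

lemma linear_hsimplex_form: "linear (hsimplex_form m)"
  by (rule linearI) (auto simp: hsimplex_form_def algebra_simps split: sum.split)

lemma facet_G_eq: "facet_G k i = {x \<in> hypersimplex k. hsimplex_form (Inl i) (1, x) = 0}"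
  and facet_F_eq: "facet_F k i = {x \<in> hypersimplex k. hsimplex_form (Inr i) (1, x) = 0}"
  by (auto simp: facet_G_def facet_F_def hsimplex_form_def)

text \<open>The slice of the right-hand cone at height 1 is \<open>P\<close>. At height 0 the bounds
  0 <= x_i <= t leave only the origin, so all other points are positive multiples of points at
  height 1. Empty \<open>S\<close> gives the whole cone, singletons give the facets.\<close>

lemma homogenization_hypersimplex_face:
  fixes P :: "(real^'n) set"
  assumes P: "P = {x \<in> hypersimplex k. S \<subseteq> active hsimplex_form (1, x)}" and ne: "P \<noteq> {}"
  shows "homogenization P = hface (hsimplex_space k) hsimplex_form S"
proof -
  have mem: "x \<in> P \<longleftrightarrow> (1, x) \<in> hface (hsimplex_space k) hsimplex_form S" for x
  proof -
    have "(\<forall>m. 0 \<le> hsimplex_form m (1, x)) \<longleftrightarrow> (\<forall>i. 0 \<le> x $ i \<and> x $ i \<le> 1)"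
      by (auto simp: hsimplex_form_def split: sum.split)
    then show ?thesis
      by (auto simp: P hypersimplex_eq hface_def hcone_def hsimplex_space_def)
  qed
  have scale: "t *\<^sub>R y \<in> hface (hsimplex_space k) hsimplex_form S"
    if "y \<in> hface (hsimplex_space k) hsimplex_form S" "0 \<le> t" for t and y :: "real \<times> (real^'n)"
    using that subspace_scale[OF subspace_hsimplex_space, of y k t]
    by (auto simp: hface_def hcone_def active_def linear_scale[OF linear_hsimplex_form])
  have "convex (hface (hsimplex_space k) (hsimplex_form :: 'n + 'n \<Rightarrow> _) S)"
    using hface_face_of[of _ hsimplex_form, OF subspace_hsimplex_space linear_hsimplex_form]
    by (rule face_of_imp_convex)
  have "convex P"
    unfolding convex_alt
  proof (intro ballI allI impI)
    fix x y u assume "x \<in> P" "y \<in> P" and u: "0 \<le> u \<and> u \<le> (1::real)"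
    then show "(1 - u) *\<^sub>R x + u *\<^sub>R y \<in> P"
      using convexD_alt[OF \<open>convex (hface _ _ _)\<close>, of "(1, x)" "(1, y)" u]
      by (simp add: mem)
  qed
  then have "homogenization P = {(t, t *\<^sub>R x) |t x. 0 \<le> t \<and> x \<in> P}"
    using ne by (rule homogenization_eq)
  also have "\<dots> = hface (hsimplex_space k) hsimplex_form S"
  proof (intro equalityI subsetI)
    fix y assume "y \<in> {(t, t *\<^sub>R x) |t x. 0 \<le> t \<and> x \<in> P}"
    then obtain t x where "y = t *\<^sub>R (1, x)" "0 \<le> t" "x \<in> P"
      by auto
    then show "y \<in> hface (hsimplex_space k) hsimplex_form S"
      using scale[of "(1, x)" t] mem by simp
  next
    fix y assume y: "y \<in> hface (hsimplex_space k) hsimplex_form S"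
    obtain t x where tx: "y = (t, x)"
      by (cases y)
    have b: "0 \<le> x $ i" "x $ i \<le> t" for i
      using y spec[of "\<lambda>m. 0 \<le> hsimplex_form m y" "Inr i"] spec[of "\<lambda>m. 0 \<le> hsimplex_form m y" "Inl i"]
      by (auto simp: tx hface_def hcone_def hsimplex_form_def)
    show "y \<in> {(t, t *\<^sub>R x) |t x. 0 \<le> t \<and> x \<in> P}"
    proof (cases "t = 0")
      case True
      then have "x = 0"
        using b by (simp add: vec_eq_iff order_antisym)
      then show ?thesis
        using True ne tx by auto
    next
      case False
      then have "0 < t"
        using b[of undefined] by linarith
      then have "(1 / t) *\<^sub>R y = (1, (1 / t) *\<^sub>R x)"
        by (simp add: tx)
      moreover have "(1 / t) *\<^sub>R y \<in> hface (hsimplex_space k) hsimplex_form S"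
        using scale[OF y, of "1 / t"] \<open>0 < t\<close> by simp
      ultimately have "(1 / t) *\<^sub>R x \<in> P"
        using mem by metis
      moreover have "x = t *\<^sub>R ((1 / t) *\<^sub>R x)"
        using \<open>0 < t\<close> by simp
      ultimately show ?thesis
        unfolding tx using \<open>0 < t\<close> by (auto intro!: exI[of _ t] exI[of _ "(1 / t) *\<^sub>R x"])
    qed
  qed
  finally show ?thesis .
qed

section \<open>The case k = 2: vertices, facets and realizations\<close>

definition unit_pair :: "'n \<Rightarrow> 'n \<Rightarrow> real^'n" where
  "unit_pair i j = (\<chi> l. if l = i \<or> l = j then 1 else 0)"

lemma unit_pair_nth [simp]: "unit_pair i j $ l = (if l = i \<or> l = j then 1 else 0)"
  by (simp add: unit_pair_def)

lemma unit_pair_mem: "i \<noteq> j \<Longrightarrow> unit_pair i j \<in> hypersimplex 2"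
proof -
  assume "i \<noteq> j"
  then have "(\<Sum>l\<in>UNIV. unit_pair i j $ l) = (\<Sum>l\<in>{i, j}. 1)"
    by (intro sum.mono_neutral_cong_right) auto
  with \<open>i \<noteq> j\<close> show ?thesis
    by (simp add: hypersimplex_eq)
qed

lemma ex_not_mem: "card S < CARD('n) \<Longrightarrow> \<exists>x::'n. x \<notin> S"
  by (metis UNIV_eq_I less_irrefl)

text \<open>With three indices there is a pair avoiding \<open>i\<close>, and its vertex shows that
  F_i is nonempty.\<close>

lemma homogenization_hypersimplex_2:
  assumes "CARD('n::finite) \<ge> 3"
  shows "homogenization (hypersimplex 2 :: (real^'n) set) = hcone (hsimplex_space 2) hsimplex_form"
    and "homogenization (facet_G 2 i :: (real^'n) set) = hface (hsimplex_space 2) hsimplex_form {Inl i}"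
    and "homogenization (facet_F 2 i :: (real^'n) set) = hface (hsimplex_space 2) hsimplex_form {Inr i}"
proof -
  obtain j where j: "j \<noteq> i"
    using ex_not_mem[of "{i}"] assms by auto
  obtain l where l: "l \<noteq> i" "l \<noteq> j"
    using ex_not_mem[of "{i, j}"] assms card_insert_le_m1[of 2 "{j}" i] by auto
  have "homogenization (hypersimplex 2 :: (real^'n) set) = hface (hsimplex_space 2) hsimplex_form {}"
    using unit_pair_mem[OF j] by (intro homogenization_hypersimplex_face) auto
  then show "homogenization (hypersimplex 2 :: (real^'n) set) = hcone (hsimplex_space 2) hsimplex_form"
    by (simp add: hface_def)
  show "homogenization (facet_G 2 i :: (real^'n) set) = hface (hsimplex_space 2) hsimplex_form {Inl i}"
  proof (rule homogenization_hypersimplex_face)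
    have "unit_pair i j \<in> facet_G 2 i"
      using unit_pair_mem[OF j[symmetric]] by (simp add: facet_G_def)
    then show "facet_G 2 i \<noteq> {}" by blast
  qed (simp add: facet_G_eq active_def)
  show "homogenization (facet_F 2 i :: (real^'n) set) = hface (hsimplex_space 2) hsimplex_form {Inr i}"
  proof (rule homogenization_hypersimplex_face)
    have "unit_pair l j \<in> facet_F 2 i"
      using unit_pair_mem j l by (simp add: facet_F_def)
    then show "facet_F 2 i \<noteq> {}" by blast
  qed (simp add: facet_F_eq active_def)
qed

lemma matrix_cone_eq: "matrix_cone M = hcone UNIV (\<lambda>m y. column m M \<bullet> y)"
  unfolding matrix_cone_def hcone_def g_col_def f_col_def by (auto simp: split_sum_all)

text \<open>Faces of the two cones correspond to sets of constraints that are active at some point,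
  so the combinatorial type is the family of these sets.\<close>

lemma realizations_2_face_iso:
  fixes M :: "real^('n::finite+'n)^'n"
  assumes "CARD('n) \<ge> 3"
  shows "M \<in> realizations 2 \<longleftrightarrow> (\<exists>\<phi>.
    face_lattice_iso (hcone (hsimplex_space 2 :: (real \<times> (real^'n)) set) hsimplex_form)
      (hcone UNIV (\<lambda>m y. column m M \<bullet> y)) \<phi> \<and>
    (\<forall>m. \<phi> (hface (hsimplex_space 2) hsimplex_form {m}) = hface UNIV (\<lambda>m y. column m M \<bullet> y) {m}))"
proof -
  have fac: "hface UNIV (\<lambda>m y. column m M \<bullet> y) {m} = matrix_cone M \<inter> {y. column m M \<bullet> y = 0}" for m
    by (auto simp: hface_def matrix_cone_eq active_def)
  show ?thesis
    unfolding realizations_def fac split_sum_all mem_Collect_eq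
    by (simp add: homogenization_hypersimplex_2[OF assms] flip: matrix_cone_eq)
      (simp add: g_col_def f_col_def)
qed

lemma linear_column_inner: "linear (\<lambda>y. column m M \<bullet> y)"
  by (auto simp: bounded_linear.linear bounded_linear_inner_right)

lemma realizations_2_active:
  fixes M :: "real^('n::finite+'n)^'n"
  assumes "CARD('n) \<ge> 3" "M \<in> realizations 2"
  shows "active hsimplex_form ` hcone (hsimplex_space 2) (hsimplex_form :: 'n + 'n \<Rightarrow> _) \<subseteq>
    active (\<lambda>m y. column m M \<bullet> y) ` hcone UNIV (\<lambda>m y. column m M \<bullet> y)"
  using assms(2) unfolding realizations_2_face_iso[OF assms(1)]
  by (elim exE conjE, intro face_lattice_iso_active subspace_hsimplex_space linear_hsimplex_form
      subspace_UNIV linear_column_inner) auto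

lemma realizations_2I:
  fixes M :: "real^('n::finite+'n)^'n"
  assumes "CARD('n) \<ge> 3"
    and eq: "active hsimplex_form ` hcone (hsimplex_space 2) (hsimplex_form :: 'n + 'n \<Rightarrow> _) =
      active (\<lambda>m y. column m M \<bullet> y) ` hcone UNIV (\<lambda>m y. column m M \<bullet> y)"
  shows "M \<in> realizations 2"
  unfolding realizations_2_face_iso[OF assms(1)]
  using face_lattice_iso_transport[OF subspace_hsimplex_space linear_hsimplex_form
      subspace_UNIV linear_column_inner eq] transport_hface[OF equalityD2[OF eq]]
  by blast

section \<open>Realizations in the basis of the $f_i$\<close>

text \<open>The argument is the vector of values of the f_j, so the f-constraints become coordinates
  and the cone lies in the nonnegative orthant.\<close>

definition gf_form :: "real^'n^'n \<Rightarrow> 'n + 'n \<Rightarrow> real^'n \<Rightarrow> real" where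
  "gf_form \<gamma> m x = (case m of Inl i \<Rightarrow> (\<gamma> *v x) $ i | Inr i \<Rightarrow> x $ i)"

lemma gf_form_simps [simp]:
  "gf_form \<gamma> (Inl i) x = (\<gamma> *v x) $ i"
  "gf_form \<gamma> (Inr i) x = x $ i"
  by (simp_all add: gf_form_def)

lemma linear_gf_form: "linear (gf_form \<gamma> m)"
  by (rule linearI)
    (auto simp: gf_form_def matrix_vector_right_distrib matrix_vector_mult_scaleR split: sum.split)

text \<open>The rows of \<open>\<gamma>\<close> are the coordinates of the \<open>g\<^sub>i\<close> in the basis \<open>f\<^sub>1, \<dots>, f\<^sub>n\<close>. The vertex on the edge
  \<open>i j\<close> of the simplex \<open>f \<ge> 0\<close> is cut out both by \<open>g\<^sub>i\<close> and by \<open>g\<^sub>j\<close>: this is the product condition.\<close>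

definition admissible :: "real^'n^'n \<Rightarrow> bool" where
  "admissible \<gamma> \<longleftrightarrow> (\<forall>i. \<gamma> $ i $ i < 0) \<and>
    (\<forall>i j. i \<noteq> j \<longrightarrow> 0 < \<gamma> $ i $ j \<and> \<gamma> $ i $ j * \<gamma> $ j $ i = \<gamma> $ i $ i * \<gamma> $ j $ j)"

lemma admissibleD:
  assumes "admissible \<gamma>"
  shows "\<gamma> $ i $ i < 0" and "i \<noteq> j \<Longrightarrow> 0 < \<gamma> $ i $ j"
    and "i \<noteq> j \<Longrightarrow> \<gamma> $ i $ j * \<gamma> $ j $ i = \<gamma> $ i $ i * \<gamma> $ j $ j"
  using assms unfolding admissible_def by blast+

text \<open>Both weights, \<open>\<gamma> $ j $ i\<close> and \<open>- \<gamma> $ i $ i\<close>, are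
  positive. Column \<open>i\<close> cancels identically, column \<open>j\<close> by the product
  condition, and every other column receives a positive coefficient.\<close>

lemma admissible_row_combination:
  fixes \<gamma> :: "real^'n^'n"
  assumes adm: "admissible \<gamma>" and x: "\<And>l. 0 \<le> x $ l" and ij: "i \<noteq> j"
  shows "0 \<le> \<gamma> $ j $ i * (\<gamma> *v x) $ i - \<gamma> $ i $ i * (\<gamma> *v x) $ j" (is "0 \<le> ?s")
    and "\<gamma> $ j $ i * (\<gamma> *v x) $ i - \<gamma> $ i $ i * (\<gamma> *v x) $ j = 0 \<longleftrightarrow> (\<forall>l. l \<noteq> i \<longrightarrow> l \<noteq> j \<longrightarrow> x $ l = 0)"
proof -
  define c where "c l = \<gamma> $ j $ i * \<gamma> $ i $ l - \<gamma> $ i $ i * \<gamma> $ j $ l" for l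
  have s: "?s = (\<Sum>l\<in>UNIV. c l * x $ l)"
    by (simp add: matrix_vector_mult_def c_def sum_distrib_left sum_subtractf left_diff_distrib mult.assoc)
  have c0: "c i = 0" "c j = 0"
    using admissibleD(3)[OF adm ij] by (simp_all add: c_def mult.commute)
  have cpos: "0 < c l" if "l \<noteq> i" "l \<noteq> j" for l
  proof -
    have "0 < \<gamma> $ j $ i * \<gamma> $ i $ l" "\<gamma> $ i $ i * \<gamma> $ j $ l < 0"
      using admissibleD[OF adm] that ij by (metis mult_pos_pos, metis mult_neg_pos)
    then show ?thesis by (simp add: c_def)
  qed
  have nn: "0 \<le> c l * x $ l" for l
    using c0 cpos[of l] x[of l] by (cases "l = i \<or> l = j") auto
  then show "0 \<le> ?s"
    unfolding s by (simp add: sum_nonneg)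
  have "?s = 0 \<longleftrightarrow> (\<forall>l. c l * x $ l = 0)"
    unfolding s using sum_nonneg_eq_0_iff[of UNIV "\<lambda>l. c l * x $ l"] nn by simp
  also have "\<dots> \<longleftrightarrow> (\<forall>l. l \<noteq> i \<longrightarrow> l \<noteq> j \<longrightarrow> x $ l = 0)"
    using c0 cpos by (metis less_irrefl mult_eq_0_iff)
  finally show "?s = 0 \<longleftrightarrow> (\<forall>l. l \<noteq> i \<longrightarrow> l \<noteq> j \<longrightarrow> x $ l = 0)" .
qed

text \<open>On the orthant g_j >= 0 is automatic once g_i = 0, with equality only on the edge i j:
  the cuts at different vertices of the simplex do not interfere.\<close>

lemma admissible_row_zero:
  fixes \<gamma> :: "real^'n^'n"
  assumes adm: "admissible \<gamma>" and x: "\<And>l. 0 \<le> x $ l" and ij: "i \<noteq> j" and 0: "(\<gamma> *v x) $ i = 0"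
  shows "0 \<le> (\<gamma> *v x) $ j" and "(\<gamma> *v x) $ j = 0 \<longleftrightarrow> (\<forall>l. l \<noteq> i \<longrightarrow> l \<noteq> j \<longrightarrow> x $ l = 0)"
proof -
  have neg: "\<gamma> $ i $ i < 0"
    using admissibleD(1)[OF adm] .
  show "0 \<le> (\<gamma> *v x) $ j"
    using admissible_row_combination(1)[OF assms(1-3)] 0 neg by (simp add: mult_le_0_iff)
  show "(\<gamma> *v x) $ j = 0 \<longleftrightarrow> (\<forall>l. l \<noteq> i \<longrightarrow> l \<noteq> j \<longrightarrow> x $ l = 0)"
    using admissible_row_combination(2)[OF assms(1-3)] 0 neg by simp
qed

text \<open>A sample point with support \<open>A\<close> on the hyperplane g_i = 0: coordinate
  \<open>i\<close> is solved from row \<open>i\<close>.\<close>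

definition facet_point :: "real^'n^'n \<Rightarrow> 'n \<Rightarrow> 'n set \<Rightarrow> real^'n" where
  "facet_point \<gamma> i A = (\<chi> l. if l = i then (\<Sum>j\<in>A - {i}. \<gamma> $ i $ j) / - \<gamma> $ i $ i else if l \<in> A then 1 else 0)"

text \<open>The point is there for its active set, which depends on \<open>i\<close> and
  \<open>A\<close> but not on \<open>\<gamma>\<close>; this permits passing from one admissible
  matrix to another. A second g_m is active only at the vertex \<open>A = {i, m}\<close>.\<close>

lemma facet_point:
  fixes \<gamma> :: "real^'n^'n"
  assumes adm: "admissible \<gamma>" and A: "i \<in> A" "A \<noteq> {i}"
  shows "facet_point \<gamma> i A \<in> hcone UNIV (gf_form \<gamma>)"
    and "active (gf_form \<gamma>) (facet_point \<gamma> i A) = Inr ` (- A) \<union> Inl ` {m. m = i \<or> A \<subseteq> {i, m}}"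
proof -
  let ?p = "facet_point \<gamma> i A"
  have neg: "\<gamma> $ i $ i < 0"
    using admissibleD(1)[OF adm] .
  have "0 < (\<Sum>j\<in>A - {i}. \<gamma> $ i $ j)"
  proof (rule sum_pos)
    show "A - {i} \<noteq> {}" using A by blast
    show "0 < \<gamma> $ i $ j" if "j \<in> A - {i}" for j
      using admissibleD(2)[OF adm, of i j] that by blast
  qed simp
  with neg have pi: "0 < ?p $ i"
    by (simp add: facet_point_def divide_pos_neg)
  have off: "?p $ l = (if l \<in> A then 1 else 0)" if "l \<noteq> i" for l
    using that by (simp add: facet_point_def)
  have nn: "0 \<le> ?p $ l" and supp: "?p $ l = 0 \<longleftrightarrow> l \<notin> A" for l
    using A(1) pi by (cases "l = i"; simp add: off)+
  have "(\<gamma> *v ?p) $ i = \<gamma> $ i $ i * ?p $ i + (\<Sum>l\<in>UNIV - {i}. \<gamma> $ i $ l * ?p $ l)"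
    unfolding matrix_vector_mult_def by (simp add: sum.remove[of UNIV i])
  also have "(\<Sum>l\<in>UNIV - {i}. \<gamma> $ i $ l * ?p $ l) = (\<Sum>l\<in>A - {i}. \<gamma> $ i $ l)"
    by (intro sum.mono_neutral_cong_right) (auto simp: off)
  also have "\<gamma> $ i $ i * ?p $ i = - (\<Sum>l\<in>A - {i}. \<gamma> $ i $ l)"
    using neg by (simp add: facet_point_def)
  finally have zero: "(\<gamma> *v ?p) $ i = 0"
    by simp
  note row = admissible_row_zero[OF adm nn _ zero]
  have "0 \<le> (\<gamma> *v ?p) $ j" for j
    using row(1)[of j] zero by (cases "j = i") auto
  then show "?p \<in> hcone UNIV (gf_form \<gamma>)"
    using nn by (simp add: hcone_def split_sum_all)
  have "(\<gamma> *v ?p) $ j = 0 \<longleftrightarrow> j = i \<or> A \<subseteq> {i, j}" for j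
  proof (cases "j = i")
    case False
    then have "(\<gamma> *v ?p) $ j = 0 \<longleftrightarrow> (\<forall>l. l \<noteq> i \<longrightarrow> l \<noteq> j \<longrightarrow> l \<notin> A)"
      using row(2)[of j] by (simp add: supp)
    with False show ?thesis by blast
  qed (simp add: zero)
  then show "active (gf_form \<gamma>) ?p = Inr ` (- A) \<union> Inl ` {m. m = i \<or> A \<subseteq> {i, m}}"
  proof (intro set_eqI)
    show "m \<in> active (gf_form \<gamma>) ?p \<longleftrightarrow> m \<in> Inr ` (- A) \<union> Inl ` {m. m = i \<or> A \<subseteq> {i, m}}" for m
      by (cases m) (auto simp: active_def supp \<open>\<And>j. (\<gamma> *v ?p) $ j = 0 \<longleftrightarrow> j = i \<or> A \<subseteq> {i, j}\<close>)
  qed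
qed

lemma active_add:
  assumes "\<And>m. linear (h m)" "x \<in> hcone UNIV h" "y \<in> hcone UNIV h"
  shows "x + y \<in> hcone UNIV h" and "active h (x + y) = active h x \<inter> active h y"
proof -
  have nn: "0 \<le> h m x" "0 \<le> h m y" for m
    using assms(2,3) by (auto simp: hcone_def)
  have add: "h m (x + y) = h m x + h m y" for m
    by (rule linear_add[OF assms(1)])
  show "x + y \<in> hcone UNIV h"
    using nn by (simp add: hcone_def add)
  show "active h (x + y) = active h x \<inter> active h y"
    using nn by (auto simp: active_def add add_nonneg_eq_0_iff)
qed

text \<open>One inclusion suffices, as the two matrices are interchangeable. If some row
  \<open>i\<close> vanishes at \<open>x\<close>, the support \<open>A\<close> determines the active
  set, and \<open>facet_point\<close> reproduces it; if no row vanishes, a sum of two such points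
  does.\<close>

lemma active_gf_form_subset:
  fixes \<gamma> \<gamma>' :: "real^'n^'n"
  assumes adm: "admissible \<gamma>" and adm': "admissible \<gamma>'"
  shows "active (gf_form \<gamma>) ` hcone UNIV (gf_form \<gamma>) \<subseteq> active (gf_form \<gamma>') ` hcone UNIV (gf_form \<gamma>')"
proof
  fix Z assume "Z \<in> active (gf_form \<gamma>) ` hcone UNIV (gf_form \<gamma>)"
  then obtain x where x: "x \<in> hcone UNIV (gf_form \<gamma>)" and Z: "Z = active (gf_form \<gamma>) x"
    by blast
  have nn: "0 \<le> x $ l" "0 \<le> (\<gamma> *v x) $ l" for l
    using x by (auto simp: hcone_def dest: spec[of _ "Inl l"] spec[of _ "Inr l"])
  define A where "A = {l. x $ l \<noteq> 0}"
  define T where "T = {l. (\<gamma> *v x) $ l = 0}"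
  have ZAT: "Z = Inr ` (- A) \<union> Inl ` T"
  proof (rule set_eqI)
    show "m \<in> Z \<longleftrightarrow> m \<in> Inr ` (- A) \<union> Inl ` T" for m
      by (cases m) (auto simp: Z A_def T_def active_def)
  qed
  have neg: "\<gamma> $ i $ i < 0" for i
    using admissibleD(1)[OF adm] .
  have row: "(\<gamma> *v x) $ i = \<gamma> $ i $ i * x $ i + (\<Sum>l\<in>UNIV - {i}. \<gamma> $ i $ l * x $ l)" for i
    by (simp add: matrix_vector_mult_def sum.remove[of UNIV i])
  \<comment> \<open>The vertex \<open>i\<close> of the simplex is cut off: g_i is negative
    there.\<close>
  have not_single: False if "A = {i}" for i
  proof -
    have "x $ l = 0" if "l \<noteq> i" for l
      using that \<open>A = {i}\<close> unfolding A_def by blast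
    then have "(\<gamma> *v x) $ i = \<gamma> $ i $ i * x $ i"
      using row[of i] by simp
    moreover have "0 < x $ i"
      using that nn(1)[of i] by (auto simp: A_def less_le)
    ultimately show False
      using nn(2)[of i] neg[of i] by (simp add: zero_le_mult_iff)
  qed
  show "Z \<in> active (gf_form \<gamma>') ` hcone UNIV (gf_form \<gamma>')"
  proof (cases "A = {}")
    case True
    then have "x = 0"
      by (auto simp: A_def vec_eq_iff)
    then have "Z = active (gf_form \<gamma>') 0" "0 \<in> hcone UNIV (gf_form \<gamma>')"
      by (auto simp: Z active_def hcone_def linear_0[OF linear_gf_form])
    then show ?thesis by blast
  next
    case A: False
    show ?thesis
    proof (cases "T = {}")
      case False
      then obtain i where i: "(\<gamma> *v x) $ i = 0"
        by (auto simp: T_def)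
      \<comment> \<open>If x_i = 0, then row \<open>i\<close> is a sum of nonnegative terms with
        positive coefficients, and its vanishing kills all other coordinates.\<close>
      have "i \<in> A"
      proof (rule ccontr)
        assume "i \<notin> A"
        with i row[of i] have "(\<Sum>l\<in>UNIV - {i}. \<gamma> $ i $ l * x $ l) = 0"
          by (simp add: A_def)
        moreover have "0 \<le> \<gamma> $ i $ l * x $ l" if "l \<noteq> i" for l
          using admissibleD(2)[OF adm, of i l] nn(1)[of l] that by simp
        ultimately have "\<gamma> $ i $ l * x $ l = 0" if "l \<noteq> i" for l
          using that by (subst (asm) sum_nonneg_eq_0_iff) auto
        moreover have "\<gamma> $ i $ l \<noteq> 0" if "l \<noteq> i" for l
          using admissibleD(2)[OF adm, of i l] that by simp
        ultimately have "A \<subseteq> {i}"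
          by (auto simp: A_def)
        with \<open>i \<notin> A\<close> A show False by blast
      qed
      have "A \<noteq> {i}"
        using not_single by blast
      have "m \<in> T \<longleftrightarrow> m = i \<or> A \<subseteq> {i, m}" for m
      proof (cases "m = i")
        case False
        then have "m \<in> T \<longleftrightarrow> (\<forall>l. l \<noteq> i \<longrightarrow> l \<noteq> m \<longrightarrow> x $ l = 0)"
          unfolding T_def using admissible_row_zero(2)[OF adm nn(1) _ i, of m] by simp
        with False show ?thesis
          by (auto simp: A_def)
      qed (use i in \<open>simp add: T_def\<close>)
      then have "T = {m. m = i \<or> A \<subseteq> {i, m}}"
        by blast
      then have "Z = active (gf_form \<gamma>') (facet_point \<gamma>' i A)"
        unfolding ZAT facet_point(2)[OF adm' \<open>i \<in> A\<close> \<open>A \<noteq> {i}\<close>] by simp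
      with facet_point(1)[OF adm' \<open>i \<in> A\<close> \<open>A \<noteq> {i}\<close>] show ?thesis
        by blast
    next
      case T: True
      then have pos: "0 < (\<gamma> *v x) $ l" for l
        using nn(2)[of l] by (auto simp: T_def less_le)
      obtain i where "i \<in> A" using A by blast
      then obtain j where "j \<in> A" "j \<noteq> i"
        using not_single[of i] by blast
      \<comment> \<open>On the edge i j the combination of g_i and g_j is zero, which two positive
        values exclude.\<close>
      have "\<not> A \<subseteq> {i, j}"
      proof
        assume "A \<subseteq> {i, j}"
        then have "\<gamma> $ j $ i * (\<gamma> *v x) $ i - \<gamma> $ i $ i * (\<gamma> *v x) $ j = 0"
          using admissible_row_combination(2)[OF adm nn(1) \<open>j \<noteq> i\<close>[symmetric]] by (auto simp: A_def)
        moreover have "0 < \<gamma> $ j $ i * (\<gamma> *v x) $ i"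
          using admissibleD(2)[OF adm \<open>j \<noteq> i\<close>] pos[of i] by simp
        moreover have "\<gamma> $ i $ i * (\<gamma> *v x) $ j < 0"
          using neg[of i] pos[of j] by (simp add: mult_neg_pos)
        ultimately show False by simp
      qed
      \<comment> \<open>The support has at least three elements, so each of the two points has
        exactly one vanishing row, and their sum has none.\<close>
      then have "{m. m = i \<or> A \<subseteq> {i, m}} \<inter> {m. m = j \<or> A \<subseteq> {j, m}} = {}"
        using \<open>i \<in> A\<close> \<open>j \<in> A\<close> \<open>j \<noteq> i\<close> by blast
      moreover have "A \<noteq> {i}" "A \<noteq> {j}"
        using not_single by blast+
      note fi = facet_point[OF adm' \<open>i \<in> A\<close> this(1)] and fj = facet_point[OF adm' \<open>j \<in> A\<close> this(2)]
      ultimately have "Z = active (gf_form \<gamma>') (facet_point \<gamma>' i A + facet_point \<gamma>' j A)"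
        unfolding active_add(2)[OF linear_gf_form fi(1) fj(1)] fi(2) fj(2) ZAT T by blast
      moreover note active_add(1)[OF linear_gf_form fi(1) fj(1)]
      ultimately show ?thesis by blast
    qed
  qed
qed

section \<open>Change of coordinates, and the matrix of the hypersimplex\<close>

lemma active_hcone_cong:
  assumes "\<And>m y. y \<in> V \<Longrightarrow> h m y = c m * k m (L y)" "\<And>m. 0 < c m" "L ` V = W"
  shows "active h ` hcone V h = active k ` hcone W k"
proof -
  have [simp]: "c m \<noteq> 0" for m
    using assms(2)[of m] by simp
  have "active h y = active k (L y)" if "y \<in> V" for y
    using that assms(1,2) by (simp add: active_def)
  moreover have "y \<in> hcone V h \<longleftrightarrow> y \<in> V \<and> L y \<in> hcone W k" for y
  proof -
    have "0 \<le> h m y \<longleftrightarrow> 0 \<le> k m (L y)" if "y \<in> V" for m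
      using that assms(1)[OF that, of m] assms(2)[of m] by (simp add: zero_le_mult_iff)
    then show ?thesis
      using assms(3) by (auto simp: hcone_def)
  qed
  moreover have "\<exists>y\<in>V. z = L y" if "z \<in> hcone W k" for z
    using that assms(3) by (auto simp: hcone_def)
  ultimately show ?thesis
    by (auto simp: image_iff) metis+
qed

text \<open>On the hyperplane where the x_i sum to k t, the form k (t - x_i) has coefficient 1 - k
  at x_i and 1 elsewhere. The product condition then reads (1 - k)^2 = 1, which among positive k
  singles out k = 2.\<close>

definition hsimplex_gamma :: "real^'n^'n" where
  "hsimplex_gamma = (\<chi> i j. if i = j then - 1 else 1)"

lemma admissible_hsimplex_gamma: "admissible hsimplex_gamma"
  by (simp add: admissible_def hsimplex_gamma_def)

lemma active_hsimplex_form: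
  "active hsimplex_form ` hcone (hsimplex_space 2) hsimplex_form =
    active (gf_form hsimplex_gamma) ` hcone (UNIV :: (real^'n) set) (gf_form hsimplex_gamma)"
proof (rule active_hcone_cong[where L = snd and c = "case_sum (\<lambda>_. 1 / 2) (\<lambda>_. 1)"])
  show "snd ` hsimplex_space 2 = (UNIV :: (real^'n) set)"
  proof -
    have "x \<in> snd ` hsimplex_space 2" for x :: "real^'n"
      by (rule image_eqI[of _ _ "((\<Sum>i\<in>UNIV. x $ i) / 2, x)"]) (auto simp: hsimplex_space_def)
    then show ?thesis by blast
  qed
  fix m :: "'n + 'n" and y :: "real \<times> (real^'n)"
  show "0 < (case m of Inl _ \<Rightarrow> (1 / 2) | Inr _ \<Rightarrow> (1 :: real))"
    by (simp split: sum.split)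
  assume "y \<in> hsimplex_space 2"
  then have y: "(\<Sum>i\<in>UNIV. snd y $ i) = 2 * fst y"
    by (simp add: hsimplex_space_def)
  have "(hsimplex_gamma *v snd y) $ i = 2 * (fst y - snd y $ i)" for i
  proof -
    have "(hsimplex_gamma *v snd y) $ i = - snd y $ i + (\<Sum>l\<in>UNIV - {i}. snd y $ l)"
      by (simp add: matrix_vector_mult_def hsimplex_gamma_def sum.remove[of UNIV i])
    also have "(\<Sum>l\<in>UNIV - {i}. snd y $ l) = 2 * fst y - snd y $ i"
      using y by (simp add: sum_diff1)
    finally show ?thesis by simp
  qed
  then show "hsimplex_form m y = (case m of Inl _ \<Rightarrow> 1 / 2 | Inr _ \<Rightarrow> 1) * gf_form hsimplex_gamma m (snd y)"
    by (simp add: hsimplex_form_def gf_form_def split: sum.split)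
qed

section \<open>Realizations versus admissible matrices\<close>

definition f_matrix :: "real^('n+'n)^'n \<Rightarrow> real^'n^'n" where
  "f_matrix M = (\<chi> r j. M $ r $ Inr j)"

lemma column_f_matrix: "column j (f_matrix M) = column (Inr j) M"
  by (simp add: column_def f_matrix_def vec_eq_iff)

lemma vector_mult_f_matrix_nth: "(y v* f_matrix M) $ j = column (Inr j) M \<bullet> y"
  by (simp add: vector_matrix_mult_def f_matrix_def column_def inner_vec_def mult.commute)

lemma column_Inl_inner:
  assumes "column (Inl i) M = f_matrix M *v \<gamma> $ i"
  shows "column (Inl i) M \<bullet> y = (\<gamma> *v (y v* f_matrix M)) $ i"
proof -
  have "column (Inl i) M \<bullet> y = y \<bullet> (f_matrix M *v \<gamma> $ i)"
    by (simp add: assms inner_commute)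
  also have "\<dots> = (y v* f_matrix M) \<bullet> \<gamma> $ i"
    by (simp add: dot_lmul_matrix)
  also have "\<dots> = (\<gamma> *v (y v* f_matrix M)) $ i"
    by (simp add: matrix_vector_mul_component inner_commute)
  finally show ?thesis .
qed

text \<open>Taking the values of the f_j as coordinates is onto because \<open>f_matrix M\<close> is
  invertible; this gives the cone the active sets of \<open>gf_form \<gamma>\<close>, which are
  those of the hypersimplex.\<close>

lemma realizations_2_if_admissible:
  fixes M :: "real^('n::finite+'n)^'n"
  assumes "CARD('n) \<ge> 3" "invertible (f_matrix M)" "admissible \<gamma>"
    and g: "\<And>i. column (Inl i) M = f_matrix M *v \<gamma> $ i"
  shows "M \<in> realizations 2"
proof (rule realizations_2I[OF assms(1)])
  have "active (\<lambda>m y. column m M \<bullet> y) ` hcone UNIV (\<lambda>m y. column m M \<bullet> y) =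
      active (gf_form \<gamma>) ` hcone UNIV (gf_form \<gamma>)"
  proof (rule active_hcone_cong[where L = "\<lambda>y. y v* f_matrix M" and c = "\<lambda>_. 1"])
    show "range (\<lambda>y. y v* f_matrix M) = UNIV"
    proof -
      have "invertible (transpose (f_matrix M))"
        using assms(2) by (simp add: transpose_invertible)
      then have "surj ((*v) (transpose (f_matrix M)))"
        unfolding invertible_eq_bij by (rule bij_is_surj)
      then show ?thesis
        by (simp add: surj_def transpose_matrix_vector)
    qed
    fix m y
    show "column m M \<bullet> y = 1 * gf_form \<gamma> m (y v* f_matrix M)"
      by (cases m) (simp_all add: column_Inl_inner[OF g] vector_mult_f_matrix_nth)
  qed simp
  then show "active hsimplex_form ` hcone (hsimplex_space 2) (hsimplex_form :: 'n + 'n \<Rightarrow> _) =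
      active (\<lambda>m y. column m M \<bullet> y) ` hcone UNIV (\<lambda>m y. column m M \<bullet> y)"
    using active_gf_form_subset[OF assms(3) admissible_hsimplex_gamma]
      active_gf_form_subset[OF admissible_hsimplex_gamma assms(3)]
    by (simp add: active_hsimplex_form)
qed

text \<open>All is read off at points \<open>w i j\<close> with the active set of the vertex e_i +
  e_j: only f_i and f_j are nonzero there, and only g_i and g_j vanish. Each pair thus yields
  equations with two terms.\<close>

lemma realizations_2_admissible:
  fixes M :: "real^('n::finite+'n)^'n"
  assumes n: "CARD('n) \<ge> 3" and M: "M \<in> realizations 2"
  obtains \<gamma> where "invertible (f_matrix M)" "admissible \<gamma>"
    "\<And>i. column (Inl i) M = f_matrix M *v \<gamma> $ i"
proof -
  have ex: "\<exists>w. (\<forall>l. 0 \<le> column (Inr l) M \<bullet> w \<and> 0 \<le> column (Inl l) M \<bullet> w) \<and>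
      (\<forall>l. column (Inr l) M \<bullet> w = 0 \<longleftrightarrow> l \<noteq> i \<and> l \<noteq> j) \<and> (\<forall>l. column (Inl l) M \<bullet> w = 0 \<longleftrightarrow> l = i \<or> l = j)"
    if "i \<noteq> j" for i j
  proof -
    have "(1, unit_pair i j) \<in> hcone (hsimplex_space 2) hsimplex_form"
      using unit_pair_mem[OF that]
      by (auto simp: hypersimplex_eq hcone_def hsimplex_space_def hsimplex_form_def split: sum.split)
    then obtain w where w: "w \<in> hcone UNIV (\<lambda>m y. column m M \<bullet> y)"
      "active (\<lambda>m y. column m M \<bullet> y) w = active hsimplex_form (1, unit_pair i j)"
      using realizations_2_active[OF n M] by (metis (no_types, lifting) image_iff subset_iff)
    then have "column m M \<bullet> w = 0 \<longleftrightarrow> hsimplex_form m (1, unit_pair i j) = 0" for m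
      by (auto simp: active_def)
    with w(1) show ?thesis
      by (intro exI[of _ w]) (auto simp: hcone_def hsimplex_form_def)
  qed
  define w where "w i j = (SOME w. (\<forall>l. 0 \<le> column (Inr l) M \<bullet> w \<and> 0 \<le> column (Inl l) M \<bullet> w) \<and>
      (\<forall>l. column (Inr l) M \<bullet> w = 0 \<longleftrightarrow> l \<noteq> i \<and> l \<noteq> j) \<and> (\<forall>l. column (Inl l) M \<bullet> w = 0 \<longleftrightarrow> l = i \<or> l = j))" for i j
  have f_ge: "0 \<le> column (Inr l) M \<bullet> w i j" and g_ge: "0 \<le> column (Inl l) M \<bullet> w i j"
    and f0: "column (Inr l) M \<bullet> w i j = 0 \<longleftrightarrow> l \<noteq> i \<and> l \<noteq> j"
    and g0: "column (Inl l) M \<bullet> w i j = 0 \<longleftrightarrow> l = i \<or> l = j" if "i \<noteq> j" for i j l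
    using someI_ex[OF ex[OF that]] unfolding w_def[symmetric] by blast+
  define p q where "p i j = column (Inr i) M \<bullet> w i j" and "q i j = column (Inr j) M \<bullet> w i j" for i j
  have p: "0 < p i j" and q: "0 < q i j" if "i \<noteq> j" for i j
    using f_ge[OF that] f0[OF that] by (auto simp: p_def q_def less_le)
  have third: "\<exists>k. k \<noteq> i \<and> k \<noteq> j" for i j :: 'n
    using ex_not_mem[of "{i, j}"] n card_insert_le_m1[of 2 "{j}" i] by auto
  have two: "(\<Sum>l\<in>UNIV. c l * (column (Inr l) M \<bullet> w i j)) = c i * p i j + c j * q i j"
    if "i \<noteq> j" for c i j
  proof -
    have "(\<Sum>l\<in>UNIV. c l * (column (Inr l) M \<bullet> w i j)) = (\<Sum>l\<in>{i, j}. c l * (column (Inr l) M \<bullet> w i j))"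
      using f0[OF that] by (intro sum.mono_neutral_right) auto
    with that show ?thesis by (simp add: p_def q_def)
  qed
  \<comment> \<open>Pairing with \<open>w i j\<close> leaves two terms with positive weights, so the
    coefficients at any two indices are opposite in sign or both zero.\<close>
  have "c i = 0" if c: "(\<Sum>l\<in>UNIV. c l *s column l (f_matrix M)) = 0" for c i
  proof -
    have pair: "c i * p i j + c j * q i j = 0" if "i \<noteq> j" for i j
      using arg_cong[OF c, of "\<lambda>v. v \<bullet> w i j"] two[OF that, of c]
      by (simp add: inner_sum_left column_f_matrix scalar_mult_eq_scaleR)
    have opp: "(c i > 0 \<longleftrightarrow> c j < 0) \<and> (c i < 0 \<longleftrightarrow> c j > 0)" if "i \<noteq> j" for i j
      using pair[OF that] p[OF that] q[OF that]
      by (smt (verit, ccfv_SIG) mult_neg_pos mult_pos_pos mult_eq_0_iff)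
    obtain j where "j \<noteq> i" using third by blast
    obtain k where "k \<noteq> i" "k \<noteq> j" using third by blast
    show "c i = 0"
      using opp[of i j] opp[of i k] opp[of j k] \<open>j \<noteq> i\<close> \<open>k \<noteq> i\<close> \<open>k \<noteq> j\<close>
      by (metis less_irrefl less_asym linorder_neqE)
  qed
  then have "\<exists>B. B ** f_matrix M = mat 1"
    unfolding matrix_left_invertible_independent_columns by blast
  then have inv: "invertible (f_matrix M)"
    by (simp add: invertible_left_inverse)
  then obtain B where B: "f_matrix M ** B = mat 1"
    by (auto simp: invertible_def)
  define \<gamma> :: "real^'n^'n" where "\<gamma> = (\<chi> i. B *v column (Inl i) M)"
  have g: "column (Inl i) M = f_matrix M *v \<gamma> $ i" for i
    by (simp add: \<gamma>_def matrix_vector_mul_assoc B)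
  have gw: "column (Inl l) M \<bullet> w i j = \<gamma> $ l $ i * p i j + \<gamma> $ l $ j * q i j" if "i \<noteq> j" for i j l
    unfolding two[OF that, symmetric]
    by (simp add: column_Inl_inner[OF g] matrix_vector_mult_def vector_mult_f_matrix_nth)
  have e1: "\<gamma> $ i $ i * p i j + \<gamma> $ i $ j * q i j = 0"
    and e2: "\<gamma> $ j $ i * p i j + \<gamma> $ j $ j * q i j = 0" if "i \<noteq> j" for i j
    using gw[OF that] g0[OF that] by metis+
  \<comment> \<open>Otherwise the equations at the \<open>w i j\<close> make the rest of row
    \<open>i\<close> nonpositive, whereas g_i is positive at a vertex whose pair avoids
    \<open>i\<close>.\<close>
  have neg: "\<gamma> $ i $ i < 0" for i
  proof (rule ccontr)
    assume "\<not> \<gamma> $ i $ i < 0"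
    then have np: "\<gamma> $ i $ j \<le> 0" if "j \<noteq> i" for j
      using e1[OF that[symmetric]] p[OF that[symmetric]] q[OF that[symmetric]]
      by (smt (verit, ccfv_SIG) mult_nonneg_nonneg mult_pos_pos)
    obtain j where j: "j \<noteq> i" using third by blast
    obtain k where k: "k \<noteq> i" "k \<noteq> j" using third by blast
    have "0 < \<gamma> $ i $ j * p j k + \<gamma> $ i $ k * q j k"
      using gw[of j k i] g0[of j k i] g_ge[of j k i] j k by (auto simp: less_le)
    moreover have "\<gamma> $ i $ j * p j k \<le> 0" "\<gamma> $ i $ k * q j k \<le> 0"
      using np[OF j] np[OF k(1)] p[OF k(2)[symmetric]] q[OF k(2)[symmetric]]
      by (simp_all add: mult_le_0_iff)
    ultimately show False by linarith
  qed
  have "0 < \<gamma> $ i $ j \<and> \<gamma> $ i $ j * \<gamma> $ j $ i = \<gamma> $ i $ i * \<gamma> $ j $ j" if "i \<noteq> j" for i j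
  proof
    note pq = p[OF that] q[OF that]
    have "\<gamma> $ i $ i * p i j < 0"
      using neg[of i] pq(1) by (simp add: mult_neg_pos)
    then have "0 < \<gamma> $ i $ j * q i j"
      using e1[OF that] by linarith
    then show "0 < \<gamma> $ i $ j"
      using pq by (simp add: zero_less_mult_iff)
    \<comment> \<open>Multiplying the two equations at \<open>w i j\<close> and cancelling
      \<open>p i j * q i j\<close> eliminates the point.\<close>
    have "\<gamma> $ i $ j * q i j = - (\<gamma> $ i $ i * p i j)" "\<gamma> $ j $ i * p i j = - (\<gamma> $ j $ j * q i j)"
      using e1[OF that] e2[OF that] by linarith+
    then have "(\<gamma> $ i $ j * q i j) * (\<gamma> $ j $ i * p i j) = (\<gamma> $ i $ i * p i j) * (\<gamma> $ j $ j * q i j)"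
      by simp
    then have "(\<gamma> $ i $ j * \<gamma> $ j $ i) * (p i j * q i j) = (\<gamma> $ i $ i * \<gamma> $ j $ j) * (p i j * q i j)"
      by (simp only: mult_ac)
    then show "\<gamma> $ i $ j * \<gamma> $ j $ i = \<gamma> $ i $ i * \<gamma> $ j $ j"
      using pq by simp
  qed
  with neg have "admissible \<gamma>"
    by (simp add: admissible_def)
  with inv g that show thesis by blast
qed

section \<open>Projective invariants\<close>

lemma f_matrix_mult_eq_sum: "f_matrix M *v x = (\<Sum>l\<in>UNIV. x $ l *\<^sub>R column (Inr l) M)"
  by (simp add: matrix_mult_sum scalar_mult_eq_scaleR column_f_matrix)

text \<open>The numerator in Cramer's rule for the coefficient of f_k in g_i; it is polynomial in
  the entries of \<open>M\<close>.\<close>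

definition cramer_det :: "real^('n+'n)^'n \<Rightarrow> 'n \<Rightarrow> 'n \<Rightarrow> real" where
  "cramer_det M i k = det (\<chi> r l. if l = k then M $ r $ Inl i else M $ r $ Inr l)"

lemma cramer_det_eq:
  fixes M :: "real^('n::finite+'n)^'n"
  assumes "column (Inl i) M = f_matrix M *v \<gamma> $ i"
  shows "cramer_det M i k = \<gamma> $ i $ k * det (f_matrix M)"
proof -
  have "(f_matrix M *v \<gamma> $ i) $ r = M $ r $ Inl i" for r
    unfolding assms[symmetric] by (simp add: column_def)
  moreover have "f_matrix M $ r $ l = M $ r $ Inr l" for r l
    by (simp add: f_matrix_def)
  ultimately show ?thesis
    unfolding cramer_lemma[of k "f_matrix M" "\<gamma> $ i", symmetric] by (simp add: cramer_det_def cong: if_cong)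
qed

lemma real_polynomial_function_component: "real_polynomial_function (\<lambda>x::real^'n. x $ i)"
  by (rule real_polynomial_function.intros(1)) (rule bounded_linear_vec_nth)

lemma real_polynomial_function_entry: "real_polynomial_function (\<lambda>M::real^'m^'n. M $ i $ j)"
  by (rule real_polynomial_function.intros(1))
    (rule bounded_linear_compose[OF bounded_linear_vec_nth bounded_linear_vec_nth])

lemma real_polynomial_function_cramer_det:
  "real_polynomial_function (\<lambda>M::real^('n::finite+'n)^'n. cramer_det M i k)"
  unfolding cramer_det_def det_def
proof (intro real_polynomial_function_sum real_polynomial_function.intros(4) real_polynomial_function.intros(2)
    real_polynomial_function_prod)
  fix p r
  show "real_polynomial_function (\<lambda>M::real^('n+'n)^'n.
      (\<chi> r l. if l = k then M $ r $ Inl i else M $ r $ Inr l) $ r $ p r)"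
    by (cases "p r = k") (simp_all add: real_polynomial_function_entry)
qed (simp_all add: finite_permutations)

section \<open>Rational maps\<close>

lemma rational_map_on_continuous:
  assumes "rational_map_on S \<phi>"
  shows "continuous_on S \<phi>"
proof -
  have "continuous_on S (\<lambda>x. \<phi> x \<bullet> b)" if b: "b \<in> Basis" for b
  proof -
    obtain p q where p: "real_polynomial_function p" and q: "real_polynomial_function q"
      and pq: "\<forall>x\<in>S. q x \<noteq> 0 \<and> \<phi> x \<bullet> b = p x / q x"
      using bspec[OF assms[unfolded rational_map_on_def] b] by (elim exE conjE)
    have "continuous_on S p" "continuous_on S q"
      using continuous_real_polymonial_function[OF p] continuous_real_polymonial_function[OF q]
      by (simp_all add: continuous_at_imp_continuous_on)
    then have "continuous_on S (\<lambda>x. p x / q x)"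
      using pq by (intro continuous_on_divide) simp_all
    then show ?thesis
      by (rule continuous_on_eq) (simp add: pq)
  qed
  then show ?thesis
    by (subst continuous_on_componentwise) blast
qed

lemma rational_map_on_vecI:
  fixes \<phi> :: "'a::euclidean_space \<Rightarrow> real^'d"
  assumes "\<And>d. \<exists>p q. real_polynomial_function p \<and> real_polynomial_function q \<and>
     (\<forall>x\<in>S. q x \<noteq> 0 \<and> \<phi> x $ d = p x / q x)"
  shows "rational_map_on S \<phi>"
  unfolding rational_map_on_def
proof
  fix e :: "real^'d" assume "e \<in> Basis"
  then obtain d where "e = axis d 1"
    by (auto simp: Basis_vec_def)
  then have "\<phi> x \<bullet> e = \<phi> x $ d" for x
    by (simp add: inner_axis)
  with assms[of d] show "\<exists>p q. real_polynomial_function p \<and> real_polynomial_function q \<and>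
     (\<forall>x\<in>S. q x \<noteq> 0 \<and> \<phi> x \<bullet> e = p x / q x)"
    by simp
qed

lemma rational_map_on_matrixI:
  fixes \<phi> :: "'a::euclidean_space \<Rightarrow> real^'m^'d"
  assumes "\<And>d c. \<exists>p q. real_polynomial_function p \<and> real_polynomial_function q \<and>
     (\<forall>x\<in>S. q x \<noteq> 0 \<and> \<phi> x $ d $ c = p x / q x)"
  shows "rational_map_on S \<phi>"
  unfolding rational_map_on_def
proof
  fix e :: "real^'m^'d" assume "e \<in> Basis"
  then obtain d c where "e = axis d (axis c 1)"
    by (auto simp: Basis_vec_def)
  then have "\<phi> x \<bullet> e = \<phi> x $ d $ c" for x
    by (simp add: inner_axis)
  with assms[of d c] show "\<exists>p q. real_polynomial_function p \<and> real_polynomial_function q \<and>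
     (\<forall>x\<in>S. q x \<noteq> 0 \<and> \<phi> x \<bullet> e = p x / q x)"
    by simp
qed

text \<open>The coordinates of the cube enumerate the triangles through \<open>z\<close>. The order
  within a pair fixes the direction in which the 3-cycle is traversed.\<close>

locale pair_indexing =
  fixes z :: "'n::finite" and a b :: "'d::finite \<Rightarrow> 'n"
  assumes a: "a d \<noteq> z" and b: "b d \<noteq> z" and ab: "a d \<noteq> b d"
    and ex: "i \<noteq> z \<Longrightarrow> j \<noteq> z \<Longrightarrow> i \<noteq> j \<Longrightarrow> \<exists>d. {a d, b d} = {i, j}"
    and unique: "{a d, b d} = {a d', b d'} \<Longrightarrow> d = d'"

text \<open>The dimension of the cube is the number of two-element subsets of the n - 1 indices
  other than \<open>z\<close>.\<close>

lemma ex_pair_indexing: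
  assumes "CARD('d::finite) = (CARD('n::finite) - 1) choose 2"
  shows "\<exists>a b. pair_indexing (z::'n) a (b :: 'd \<Rightarrow> 'n)"
proof -
  let ?P = "{S. S \<subseteq> - {z} \<and> card S = 2}"
  have "card ?P = card (- {z}) choose 2"
    by (rule n_subsets) simp
  then have "card ?P = CARD('d)"
    using assms by (simp add: Compl_eq_Diff_UNIV)
  then obtain s where s: "bij_betw s (UNIV :: 'd set) ?P"
    using finite_same_card_bij[of "UNIV :: 'd set" ?P] by auto
  have "\<exists>x y. s d = {x, y} \<and> x \<noteq> y" and "z \<notin> s d" for d
  proof -
    have "s d \<in> ?P" using bij_betwE[OF s] by blast
    then show "\<exists>x y. s d = {x, y} \<and> x \<noteq> y" "z \<notin> s d"
      unfolding card_2_iff by blast+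
  qed
  then obtain a b where sab: "\<And>d. s d = {a d, b d}" and neq: "\<And>d. a d \<noteq> b d"
    by metis
  have "pair_indexing z a b"
  proof
    fix i j assume "i \<noteq> z" "j \<noteq> z" "i \<noteq> j"
    then have "{i, j} \<in> ?P" by auto
    then obtain d where "{i, j} = s d"
      using s unfolding bij_betw_def by blast
    then show "\<exists>d. {a d, b d} = {i, j}"
      unfolding sab by (intro exI[of _ d]) (rule sym)
  next
    fix d d' assume "{a d, b d} = {a d', b d'}"
    then have "s d = s d'"
      unfolding sab .
    then show "d = d'"
      using s unfolding bij_betw_def by (blast dest: injD)
  next
    show "a d \<noteq> z" "b d \<noteq> z" for d
      using \<open>\<And>d. z \<notin> s d\<close>[of d] unfolding sab by blast+
  qed (rule neq)
  then show ?thesis by blast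
qed

definition matrix_of_gamma :: "real^'n^'n \<Rightarrow> real^('n::finite+'n)^'n" where
  "matrix_of_gamma \<gamma> = (\<chi> r c. case c of Inl i \<Rightarrow> \<gamma> $ i $ r | Inr j \<Rightarrow> if r = j then 1 else 0)"

lemma f_matrix_of_gamma: "f_matrix (matrix_of_gamma \<gamma>) = mat 1"
  by (simp add: f_matrix_def matrix_of_gamma_def mat_def)

lemma column_Inl_matrix_of_gamma: "column (Inl i) (matrix_of_gamma \<gamma>) = \<gamma> $ i"
  by (simp add: column_def matrix_of_gamma_def)

lemma column_Inr_matrix_of_gamma: "column (Inr j) (matrix_of_gamma \<gamma>) = axis j 1"
  by (simp add: column_def matrix_of_gamma_def axis_def)

lemma invertible_mat_1: "invertible (mat 1 :: real^'n^'n)"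
  by (simp add: invertible_det_nz)

lemma matrix_of_gamma_realization:
  assumes "CARD('n::finite) \<ge> 3" "admissible (\<gamma> :: real^'n^'n)"
  shows "matrix_of_gamma \<gamma> \<in> realizations 2"
  using assms by (intro realizations_2_if_admissible[of _ \<gamma>])
    (simp_all add: f_matrix_of_gamma column_Inl_matrix_of_gamma invertible_mat_1)

context pair_indexing
begin

text \<open>Rescaling \<open>f\<^sub>i\<close> by \<open>c\<^sub>i\<close> conjugates the matrix \<open>\<gamma>\<^sub>i\<^sub>j / -\<gamma>\<^sub>i\<^sub>i\<close> by a diagonal matrix, so its products along
  the 3-cycles through \<open>z\<close> are projective invariants. A product \<open>\<tau> > 0\<close> enters as \<open>\<tau> / (1 + \<tau>)\<close>.\<close>

definition cycle_coord :: "('n \<Rightarrow> 'n \<Rightarrow> real) \<Rightarrow> 'd \<Rightarrow> real" where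
  "cycle_coord D d = D z (a d) * D (a d) (b d) * D (b d) z /
    (D z (a d) * D (a d) (b d) * D (b d) z - D z z * D (a d) (a d) * D (b d) (b d))"

text \<open>Determinants replace the entries of \<open>\<gamma>\<close>: numerator and denominator
  are homogeneous of degree 3, so the common factor \<open>det (f_matrix M)\<close> cancels.\<close>

definition coord :: "real^('n+'n)^'n \<Rightarrow> real^'d" where
  "coord M = (\<chi> d. cycle_coord (cramer_det M) d)"

text \<open>In both products each of \<open>z\<close>, \<open>a d\<close>, \<open>b d\<close> occurs
  once as a row and once as a column, so both acquire the same factor. This serves for the
  determinant in Cramer's rule and for the rescaling of columns.\<close>

lemma cycle_coord_scale:
  assumes "\<And>i. c i \<noteq> 0" "\<And>i. e i \<noteq> 0" "\<And>i j. D' i j = c i * D i j * e j"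
  shows "cycle_coord D' d = cycle_coord D d"
proof -
  let ?k = "c z * c (a d) * c (b d) * (e z * e (a d) * e (b d))"
  let ?P = "D z (a d) * D (a d) (b d) * D (b d) z" and ?Q = "D z z * D (a d) (a d) * D (b d) (b d)"
  have "?k \<noteq> 0"
    using assms(1,2) by simp
  have "cycle_coord D' d = (?k * ?P) / (?k * ?P - ?k * ?Q)"
    unfolding cycle_coord_def assms(3) by (simp only: mult_ac)
  also have "\<dots> = (?k * ?P) / (?k * (?P - ?Q))"
    by (simp only: right_diff_distrib)
  also have "\<dots> = cycle_coord D d"
    using \<open>?k \<noteq> 0\<close> unfolding cycle_coord_def by (rule mult_divide_mult_cancel_left)
  finally show ?thesis .
qed

lemma coord_eq:
  assumes "invertible (f_matrix M)" "\<And>i. column (Inl i) M = f_matrix M *v \<gamma> $ i"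
  shows "coord M $ d = cycle_coord (\<lambda>i j. \<gamma> $ i $ j) d"
  unfolding coord_def using assms
  by (simp add: cramer_det_eq[OF assms(2)] invertible_det_nz
      cycle_coord_scale[where c = "\<lambda>_. det (f_matrix M)" and e = "\<lambda>_. 1" and D = "\<lambda>i j. \<gamma> $ i $ j"])

lemma cycle_signs:
  assumes "admissible \<gamma>"
  shows "0 < \<gamma> $ z $ a d * \<gamma> $ a d $ b d * \<gamma> $ b d $ z"
    and "\<gamma> $ z $ z * \<gamma> $ a d $ a d * \<gamma> $ b d $ b d < 0"
  using admissibleD(1)[OF assms] admissibleD(2)[OF assms] a[of d] b[of d] ab[of d]
  by (metis mult_pos_pos, metis mult_neg_neg mult_pos_neg)

lemma coord_mem_box:
  assumes "CARD('n) \<ge> 3" "M \<in> realizations 2"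
  shows "coord M \<in> box 0 1"
proof -
  obtain \<gamma> where \<gamma>: "invertible (f_matrix M)" "admissible \<gamma>"
    "\<And>i. column (Inl i) M = f_matrix M *v \<gamma> $ i"
    using realizations_2_admissible[OF assms] by blast
  have "0 < coord M $ d \<and> coord M $ d < 1" for d
    using cycle_signs[OF \<gamma>(2), of d] unfolding coord_eq[OF \<gamma>(1,3)] cycle_coord_def
    by (simp add: divide_pos_pos)
  then show ?thesis
    by (simp add: mem_box_cart)
qed

lemma coord_projective_equiv:
  assumes "CARD('n) \<ge> 3" "(M, N) \<in> projective_equiv 2"
  shows "coord M = coord N"
proof -
  obtain A :: "real^'n^'n" and c where MN: "M \<in> realizations 2" "N \<in> realizations 2"
    and c: "\<And>j. 0 < c j" and col: "\<And>j. column j N = c j *\<^sub>R (A *v column j M)"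
    using assms(2) unfolding projective_equiv_def by blast
  obtain \<gamma> where \<gamma>: "invertible (f_matrix M)" "\<And>i. column (Inl i) M = f_matrix M *v \<gamma> $ i"
    using realizations_2_admissible[OF assms(1) MN(1)] by blast
  obtain \<gamma>' where "invertible (f_matrix N)"
    using realizations_2_admissible[OF assms(1) MN(2)] by blast
  \<comment> \<open>The coefficients of the new g_i in the new f_j: the linear map \<open>A\<close>
    drops out.\<close>
  define \<delta> :: "real^'n^'n" where "\<delta> = (\<chi> i j. c (Inl i) * \<gamma> $ i $ j * (1 / c (Inr j)))"
  have [simp]: "c j \<noteq> 0" for j
    using c[of j] by simp
  have "column (Inl i) N = f_matrix N *v \<delta> $ i" for i
  proof -
    have "f_matrix N *v \<delta> $ i = (\<Sum>l\<in>UNIV. (c (Inl i) * \<gamma> $ i $ l) *\<^sub>R (A *v column (Inr l) M))"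
      by (simp add: f_matrix_mult_eq_sum \<delta>_def col)
    also have "\<dots> = c (Inl i) *\<^sub>R (A *v (f_matrix M *v \<gamma> $ i))"
      by (simp add: f_matrix_mult_eq_sum scaleR_sum_right vec.sum matrix_vector_mult_scaleR mult.commute
         linear_sum[OF matrix_vector_mul_linear])
    finally show ?thesis
      by (simp add: col \<gamma>(2))
  qed
  then have "coord N $ d = cycle_coord (\<lambda>i j. \<delta> $ i $ j) d" for d
    using \<open>invertible (f_matrix N)\<close> by (intro coord_eq)
  also have "\<dots> d = coord M $ d" for d
    unfolding coord_eq[OF \<gamma>]
    by (rule cycle_coord_scale[where c = "\<lambda>i. c (Inl i)" and e = "\<lambda>j. 1 / c (Inr j)"]) (simp_all add: \<delta>_def)
  finally show ?thesis
    by (simp add: vec_eq_iff)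
qed

section \<open>The normal form of a projective class\<close>

definition pair_index :: "'n \<Rightarrow> 'n \<Rightarrow> 'd" where
  "pair_index i j = (THE d. {a d, b d} = {i, j})"

lemma pair_index_eq: "{a d, b d} = {i, j} \<Longrightarrow> pair_index i j = d"
  unfolding pair_index_def by (rule the_equality) (auto intro: unique)

lemma pair_index_cases:
  assumes "i \<noteq> z" "j \<noteq> z" "i \<noteq> j"
  obtains d where "i = a d" "j = b d" | d where "i = b d" "j = a d"
  using ex[OF assms] by (metis doubleton_eq_iff)

text \<open>With the diagonal at -1 and the edges through \<open>z\<close> at 1, the 3-cycle product
  is the single entry at \<open>a d\<close>, \<open>b d\<close>. There s / (1 - s) inverts \<tau> /
  (1 + \<tau>), and the product condition forces the reciprocal at the transposed place.\<close>

definition normal_gamma :: "real^'d \<Rightarrow> real^'n^'n" where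
  "normal_gamma t = (\<chi> i j. if i = j then -1 else if i = z \<or> j = z then 1
     else let s = t $ pair_index i j in if i = a (pair_index i j) then s / (1 - s) else (1 - s) / s)"

lemma normal_gamma_simps:
  "normal_gamma t $ i $ i = -1"
  "j \<noteq> z \<Longrightarrow> normal_gamma t $ z $ j = 1"
  "j \<noteq> z \<Longrightarrow> normal_gamma t $ j $ z = 1"
  "normal_gamma t $ a d $ b d = t $ d / (1 - t $ d)"
  "normal_gamma t $ b d $ a d = (1 - t $ d) / t $ d"
  using a[of d] b[of d] ab[of d] pair_index_eq[of d "a d" "b d"] pair_index_eq[of d "b d" "a d"]
  by (simp_all add: normal_gamma_def Let_def insert_commute)

lemma admissible_normal_gamma:
  assumes "t \<in> box 0 1"
  shows "admissible (normal_gamma t)"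
proof -
  have t: "0 < t $ d" "t $ d < 1" for d
    using assms by (auto simp: mem_box_cart)
  have "0 < normal_gamma t $ i $ j \<and> normal_gamma t $ i $ j * normal_gamma t $ j $ i = 1" if "i \<noteq> j" for i j
  proof (cases "i = z \<or> j = z")
    case True
    with that show ?thesis
      by (auto simp: normal_gamma_simps)
  next
    case False
    then have "i \<noteq> z" "j \<noteq> z" by auto
    then show ?thesis
      using that t
      by (cases rule: pair_index_cases) (auto simp: normal_gamma_simps less_imp_neq[symmetric] less_imp_neq)
  qed
  then show ?thesis
    by (simp add: admissible_def normal_gamma_simps)
qed

lemma coord_normal_gamma:
  assumes "t \<in> box 0 1"
  shows "coord (matrix_of_gamma (normal_gamma t)) = t"
proof -
  have "coord (matrix_of_gamma (normal_gamma t)) $ d = t $ d" for d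
  proof -
    have t: "0 < t $ d" "t $ d < 1"
      using assms by (auto simp: mem_box_cart)
    have "coord (matrix_of_gamma (normal_gamma t)) $ d = cycle_coord (\<lambda>i j. normal_gamma t $ i $ j) d"
      by (rule coord_eq) (simp_all add: f_matrix_of_gamma column_Inl_matrix_of_gamma invertible_mat_1)
    also have "\<dots> = t $ d"
      using t a[of d] b[of d] by (simp add: cycle_coord_def normal_gamma_simps field_simps)
    finally show ?thesis .
  qed
  then show ?thesis
    by (simp add: vec_eq_iff)
qed

text \<open>The scaling \<open>c\<close> is chosen to turn row \<open>z\<close> into ones; column
  \<open>z\<close> follows by the product condition. Being a diagonal conjugation, it keeps the
  3-cycle products, and these fix the remaining entries.\<close>

lemma normal_gamma_coord:
  assumes "invertible (f_matrix M)" and adm: "admissible \<gamma>"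
    and "\<And>i. column (Inl i) M = f_matrix M *v \<gamma> $ i"
  defines "c \<equiv> \<lambda>i. if i = z then 1 else \<gamma> $ z $ i / - \<gamma> $ z $ z"
  shows "normal_gamma (coord M) $ i $ j = c i * \<gamma> $ i $ j / (- \<gamma> $ i $ i * c j)"
proof -
  note neg = admissibleD(1)[OF adm] and pos = admissibleD(2)[OF adm] and prod = admissibleD(3)[OF adm]
  have [simp]: "\<gamma> $ i $ i \<noteq> 0" for i
    using neg[of i] by simp
  have nz: "\<gamma> $ i $ j \<noteq> 0" if "i \<noteq> j" for i j
    using pos[OF that] by simp
  have c: "c i \<noteq> 0" for i
    using nz[of z i] by (auto simp: c_def)
  show ?thesis
  proof (cases "i = j \<or> i = z \<or> j = z")
    case True
    then consider "i = j" | "i = z" "j \<noteq> z" | "i \<noteq> z" "j = z" by blast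
    then show ?thesis
    proof cases
      case 1
      then show ?thesis using c by (simp add: normal_gamma_simps)
    next
      case 2
      then show ?thesis using nz[of z j] by (simp add: normal_gamma_simps c_def)
    next
      case 3
      then show ?thesis using prod[of z i] by (simp add: normal_gamma_simps c_def mult.commute)
    qed
  next
    case False
    then have ij: "i \<noteq> z" "j \<noteq> z" "i \<noteq> j" by auto
    then show ?thesis
    proof (cases rule: pair_index_cases)
      case (1 d)
      \<comment> \<open>Here P / -Q is \<tau>; the product condition for \<open>z\<close> and
        \<open>j\<close> cancels \<open>\<gamma> $ j $ z\<close> from it.\<close>
      have "P / (P - Q) / (1 - P / (P - Q)) = \<gamma> $ z $ i * \<gamma> $ i $ j / (- \<gamma> $ i $ i * \<gamma> $ z $ j)"
        if "P = \<gamma> $ z $ i * \<gamma> $ i $ j * \<gamma> $ j $ z" "Q = \<gamma> $ z $ z * \<gamma> $ i $ i * \<gamma> $ j $ j" "0 < P" "Q < 0" for P Q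
      proof -
        have "P / (P - Q) / (1 - P / (P - Q)) = P / - Q"
          using that(3,4) by (simp add: field_simps)
        moreover have "Q = (\<gamma> $ i $ i * \<gamma> $ z $ j) * \<gamma> $ j $ z"
          using prod[of z j] ij that(2) by (simp add: mult_ac)
        then have "P / - Q = \<gamma> $ z $ i * \<gamma> $ i $ j / (- \<gamma> $ i $ i * \<gamma> $ z $ j)"
          using that(1) nz[of j z] ij by simp
        ultimately show ?thesis
          by simp
      qed
      from this[OF _ _ cycle_signs[OF adm, of d]] show ?thesis
        using ij 1 by (simp add: normal_gamma_simps coord_eq[OF assms(1,3)] cycle_coord_def c_def)
    next
      case (2 d)
      \<comment> \<open>The pair is enumerated in the opposite order, so the entry is 1 / \<tau>;
        the product conditions for \<open>i\<close>, \<open>j\<close> and for \<open>i\<close>,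
        \<open>z\<close> turn it into the same expression.\<close>
      have "(1 - P / (P - Q)) / (P / (P - Q)) = \<gamma> $ z $ i * \<gamma> $ i $ j / (- \<gamma> $ i $ i * \<gamma> $ z $ j)"
        if "P = \<gamma> $ z $ j * \<gamma> $ j $ i * \<gamma> $ i $ z" "Q = \<gamma> $ z $ z * \<gamma> $ j $ j * \<gamma> $ i $ i" "0 < P" "Q < 0" for P Q
      proof -
        have "(1 - P / (P - Q)) / (P / (P - Q)) = - Q / P"
          using that(3,4) by (simp add: field_simps)
        moreover have "Q * (\<gamma> $ i $ i * \<gamma> $ z $ j) = P * (\<gamma> $ z $ i * \<gamma> $ i $ j)"
        proof -
          have "P * (\<gamma> $ z $ i * \<gamma> $ i $ j) = \<gamma> $ z $ j * (\<gamma> $ j $ i * \<gamma> $ i $ j) * (\<gamma> $ i $ z * \<gamma> $ z $ i)"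
            by (simp only: that(1) mult_ac)
          also have "\<dots> = \<gamma> $ z $ j * (\<gamma> $ j $ j * \<gamma> $ i $ i) * (\<gamma> $ i $ i * \<gamma> $ z $ z)"
            by (simp only: prod[OF ij(3)[symmetric]] prod[OF ij(1)])
          also have "\<dots> = Q * (\<gamma> $ i $ i * \<gamma> $ z $ j)"
            by (simp only: that(2) mult_ac)
          finally show ?thesis ..
        qed
        ultimately show ?thesis
          using that(3) nz[of z j] ij by (simp add: frac_eq_eq mult_ac)
      qed
      from this[OF _ _ cycle_signs[OF adm, of d]] show ?thesis
        using ij 2 by (simp add: normal_gamma_simps coord_eq[OF assms(1,3)] cycle_coord_def c_def)
    qed
  qed
qed

text \<open>The inverse of \<open>f_matrix M\<close> makes the f_i the standard basis. Scaling f_i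
  by \<open>c i\<close> is compensated by the diagonal matrix \<open>E\<close>, and the factor on
  g_i is the one that makes its diagonal entry -1.\<close>

lemma projective_equiv_normal:
  assumes "CARD('n) \<ge> 3" "M \<in> realizations 2"
  shows "(M, matrix_of_gamma (normal_gamma (coord M))) \<in> projective_equiv 2"
proof -
  obtain \<gamma> where inv: "invertible (f_matrix M)" and adm: "admissible \<gamma>"
    and g: "\<And>i. column (Inl i) M = f_matrix M *v \<gamma> $ i"
    using realizations_2_admissible[OF assms] by blast
  define c where "c i = (if i = z then 1 else \<gamma> $ z $ i / - \<gamma> $ z $ z)" for i
  note norm = normal_gamma_coord[OF inv adm g, folded c_def]
  have c: "0 < c i" for i
    using admissibleD(1,2)[OF adm, of z] by (auto simp: c_def divide_pos_neg)
  have c0: "c i \<noteq> 0" for i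
    using c[of i] by simp
  obtain B where B: "B ** f_matrix M = mat 1" "f_matrix M ** B = mat 1"
    using inv by (auto simp: invertible_def)
  define E :: "real^'n^'n" where "E = (\<chi> i j. if i = j then 1 / c i else 0)"
  have E: "(E *v v) $ i = v $ i / c i" for v i
  proof -
    have "(E *v v) $ i = (\<Sum>j\<in>UNIV. if i = j then v $ i / c i else 0)"
      unfolding matrix_vector_mult_def E_def vec_lambda_beta by (rule sum.cong) auto
    then show ?thesis by simp
  qed
  have "det E = (\<Prod>i\<in>UNIV. E $ i $ i)"
    by (rule det_diagonal) (simp add: E_def)
  then have "invertible E"
    using c0 by (simp add: invertible_det_nz E_def)
  then have "invertible (E ** B)"
    using B by (intro invertible_mult) (auto simp: invertible_def)
  moreover have "column k (matrix_of_gamma (normal_gamma (coord M))) =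
      (case k of Inl i \<Rightarrow> c i / - \<gamma> $ i $ i | Inr i \<Rightarrow> c i) *\<^sub>R ((E ** B) *v column k M)" for k
  proof (cases k)
    case (Inl i)
    have "(E ** B) *v column k M = E *v ((B ** f_matrix M) *v \<gamma> $ i)"
      by (simp add: Inl g matrix_vector_mul_assoc matrix_mul_assoc)
    then have "((E ** B) *v column k M) $ j = \<gamma> $ i $ j / c j" for j
      by (simp add: B E)
    then show ?thesis
      by (simp add: Inl column_Inl_matrix_of_gamma vec_eq_iff norm)
  next
    case (Inr i)
    have "column k M = f_matrix M *v axis i 1"
      by (simp add: Inr matrix_vector_mult_basis column_f_matrix)
    then have "(E ** B) *v column k M = E *v ((B ** f_matrix M) *v axis i 1)"
      by (simp add: matrix_vector_mul_assoc matrix_mul_assoc)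
    then have "((E ** B) *v column k M) $ j = axis i 1 $ j / c j" for j
      by (simp add: B E)
    then show ?thesis
      using c0 by (simp add: Inr column_Inr_matrix_of_gamma vec_eq_iff axis_def)
  qed
  moreover have "0 < (case k of Inl i \<Rightarrow> c i / - \<gamma> $ i $ i | Inr i \<Rightarrow> c i)" for k
    using c admissibleD(1)[OF adm] by (auto simp: divide_pos_neg split: sum.split)
  moreover have "matrix_of_gamma (normal_gamma (coord M)) \<in> realizations 2"
    using matrix_of_gamma_realization[OF assms(1) admissible_normal_gamma] coord_mem_box[OF assms] by blast
  ultimately show ?thesis
    unfolding projective_equiv_def using assms(2)
    by (intro CollectI case_prodI conjI exI[of _ "E ** B"]
        exI[of _ "\<lambda>k. case k of Inl i \<Rightarrow> c i / - \<gamma> $ i $ i | Inr i \<Rightarrow> c i"]) simp_all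
qed

lemma rational_coord:
  assumes "CARD('n) \<ge> 3"
  shows "rational_map_on (realizations 2) coord"
proof (rule rational_map_on_vecI)
  fix d
  let ?p = "\<lambda>M. cramer_det M z (a d) * cramer_det M (a d) (b d) * cramer_det M (b d) z"
  let ?q = "\<lambda>M. ?p M - cramer_det M z z * cramer_det M (a d) (a d) * cramer_det M (b d) (b d)"
  \<comment> \<open>Division by zero gives 0, so a vanishing denominator would put the coordinate at
    0, outside the open cube.\<close>
  have "?q M \<noteq> 0" if "M \<in> realizations 2" for M
  proof
    assume "?q M = 0"
    then have "coord M $ d = 0"
      by (simp add: coord_def cycle_coord_def)
    moreover have "0 < coord M $ d"
      using coord_mem_box[OF assms that] by (simp add: mem_box_cart)
    ultimately show False by simp
  qed
  then show "\<exists>p q. real_polynomial_function p \<and> real_polynomial_function q \<and>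
     (\<forall>M\<in>realizations 2. q M \<noteq> 0 \<and> coord M $ d = p M / q M)"
    by (intro exI[of _ ?p] exI[of _ ?q] conjI ballI)
      (auto simp: coord_def cycle_coord_def
        intro!: real_polynomial_function_diff real_polynomial_function.intros(4) real_polynomial_function_cramer_det)
qed

lemma rational_normal_gamma: "rational_map_on (box 0 1) (\<lambda>t. matrix_of_gamma (normal_gamma t))"
proof (rule rational_map_on_matrixI)
  fix r :: 'n and c :: "'n + 'n"
  let ?R = "\<lambda>f. \<exists>p q. real_polynomial_function p \<and> real_polynomial_function q \<and>
     (\<forall>t\<in>box 0 1. q t \<noteq> 0 \<and> f t = p t / q (t :: real^'d))"
  have const: "?R (\<lambda>_. x)" for x
    by (intro exI[of _ "\<lambda>_. x"] exI[of _ "\<lambda>_. 1"]) auto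
  have t: "0 < t $ d" "t $ d < 1" if "t \<in> box 0 1" for t :: "real^'d" and d
    using that by (auto simp: mem_box_cart)
  have quot: "?R (\<lambda>t. t $ d / (1 - t $ d))" "?R (\<lambda>t. (1 - t $ d) / t $ d)" for d
  proof -
    have pol: "real_polynomial_function (\<lambda>t::real^'d. t $ d)" "real_polynomial_function (\<lambda>t::real^'d. 1 - t $ d)"
      by (auto intro!: real_polynomial_function_component)
    show "?R (\<lambda>t. t $ d / (1 - t $ d))"
      by (intro exI[of _ "\<lambda>t. t $ d"] exI[of _ "\<lambda>t. 1 - t $ d"] conjI pol) (use t[of _ d] in force)
    show "?R (\<lambda>t. (1 - t $ d) / t $ d)"
      by (intro exI[of _ "\<lambda>t. t $ d"] exI[of _ "\<lambda>t. 1 - t $ d"] conjI pol) (use t[of _ d] in force)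
  qed
  show "?R (\<lambda>t. matrix_of_gamma (normal_gamma t) $ r $ c)"
  proof (cases c)
    case (Inr j)
    then show ?thesis
      using const by (simp add: matrix_of_gamma_def)
  next
    case (Inl i)
    consider "i = r" | "i \<noteq> r" "i = z \<or> r = z" | "i \<noteq> r" "i \<noteq> z" "r \<noteq> z" by blast
    then have "?R (\<lambda>t. normal_gamma t $ i $ r)"
    proof cases
      case 1
      then show ?thesis using const[of "-1"] by (simp add: normal_gamma_simps)
    next
      case 2
      then have "normal_gamma t $ i $ r = 1" for t
        by (auto simp: normal_gamma_simps)
      then show ?thesis using const[of 1] by simp
    next
      case 3
      from 3(2,3,1) show ?thesis
        by (cases rule: pair_index_cases) (simp_all only: normal_gamma_simps quot)
    qed
    with Inl show ?thesis
      by (simp add: matrix_of_gamma_def)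
  qed
qed

text \<open>\<open>coord\<close> and the normal form are inverse to each other modulo projective
  equivalence. Continuity of \<open>h\<close> is tested after composing with the quotient
  map.\<close>

lemma realizations_rationally_equivalent_box:
  assumes n: "CARD('n) \<ge> 3"
  shows "rationally_equivalent (realizations 2 :: (real^('n+'n)^'n) set) (projective_equiv 2) (box (0::real^'d) 1)"
proof -
  let ?S = "realizations 2 :: (real^('n+'n)^'n) set" and ?T = "box (0::real^'d) 1"
  let ?r = "projective_equiv 2 :: (real^('n+'n)^'n) rel"
  let ?Q = "quotient_topology (top_of_set ?S) ?r"
  let ?\<psi> = "\<lambda>t. matrix_of_gamma (normal_gamma t)"
  \<comment> \<open>The choice is immaterial, since \<open>coord\<close> is constant on
    classes.\<close>
  define h where "h X = coord (SOME M. M \<in> X)" for X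
  define h' where "h' t = ?r `` {?\<psi> t}" for t
  note equiv = equiv_projective_equiv[of 2, where ?'n = 'n]
  have h: "h (?r `` {M}) = coord M" if "M \<in> ?S" for M
  proof -
    have "M \<in> ?r `` {M}"
      using equiv that by (rule equiv_class_self)
    then have "(SOME N. N \<in> ?r `` {M}) \<in> ?r `` {M}"
      by (rule someI[of "\<lambda>N. N \<in> ?r `` {M}"])
    then show ?thesis
      unfolding h_def by (intro coord_projective_equiv[OF n, symmetric]) simp
  qed
  have \<psi>: "?\<psi> t \<in> ?S" if "t \<in> ?T" for t
    using matrix_of_gamma_realization[OF n admissible_normal_gamma[OF that]] .
  have top: "topspace ?Q = ?S // ?r"
    by (simp add: topspace_quotient_topology)
  note quot = quotient_map_quotient_topology[of "top_of_set ?S" ?r]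
  have "homeomorphic_maps ?Q (top_of_set ?T) h h'"
    unfolding homeomorphic_maps_def
  proof (intro conjI ballI)
    have "continuous_map (top_of_set ?S) (top_of_set ?T) coord"
      using rational_map_on_continuous[OF rational_coord[OF n]] coord_mem_box[OF n] by auto
    then have "continuous_map (top_of_set ?S) (top_of_set ?T) (h \<circ> (\<lambda>M. ?r `` {M}))"
      by (rule continuous_map_eq) (simp add: h)
    with quot show "continuous_map ?Q (top_of_set ?T) h"
      by (rule continuous_compose_quotient_map)
    have "continuous_map (top_of_set ?T) (top_of_set ?S) ?\<psi>"
      using rational_map_on_continuous[OF rational_normal_gamma] \<psi> by auto
    then have "continuous_map (top_of_set ?T) ?Q ((\<lambda>M. ?r `` {M}) \<circ> ?\<psi>)"
      using quotient_imp_continuous_map[OF quot] by (rule continuous_map_compose)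
    moreover have "(\<lambda>M. ?r `` {M}) \<circ> ?\<psi> = h'"
      by (simp add: fun_eq_iff h'_def)
    ultimately show "continuous_map (top_of_set ?T) ?Q h'"
      by simp
  next
    fix X assume "X \<in> topspace ?Q"
    then obtain M where M: "M \<in> ?S" "X = ?r `` {M}"
      unfolding top by (rule quotientE)
    then show "h' (h X) = X"
      unfolding h'_def M(2) h[OF M(1)]
      using equiv_class_eq[OF equiv projective_equiv_normal[OF n M(1)]] by simp
  next
    fix t assume "t \<in> topspace (top_of_set ?T)"
    then have "t \<in> ?T" by simp
    then show "h (h' t) = t"
      unfolding h'_def by (simp add: h \<psi> coord_normal_gamma)
  qed
  moreover have "\<exists>\<phi>. rational_map_on ?S \<phi> \<and> (\<forall>M\<in>?S. h (?r `` {M}) = \<phi> M)"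
    using rational_coord[OF n] h by blast
  moreover have "\<exists>\<psi>. rational_map_on ?T \<psi> \<and> (\<forall>t\<in>?T. \<psi> t \<in> ?S \<and> h' t = ?r `` {\<psi> t})"
    using rational_normal_gamma \<psi> h'_def by blast
  ultimately show ?thesis
    unfolding rationally_equivalent_def by (intro exI[of _ h] exI[of _ h'] conjI)
qed

end

text \<open>The closed cube and the closed ball are compact convex bodies of the same dimension,
  hence homeomorphic, and so are their interiors.\<close>

lemma box_homeomorphic_space_ball: "top_of_set (box (0::real^'d) 1) homeomorphic_space top_of_set (ball (0::real^'d) 1)"
proof -
  have "(\<chi> i. 1 / 2) \<in> box (0::real^'d) 1"
    by (simp add: mem_box_cart)
  then have ne: "interior (cbox (0::real^'d) 1) \<noteq> {}"
    unfolding interior_cbox by blast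
  have "cbox (0::real^'d) 1 homeomorphic cball (0::real^'d) 1"
    by (rule homeomorphic_convex_compact_cball) (use ne in \<open>simp_all add: convex_box compact_cbox\<close>)
  then have "interior (cbox (0::real^'d) 1) homeomorphic interior (cball (0::real^'d) 1)"
    by (rule homeomorphic_interiors) (use ne in \<open>simp add: interior_cball\<close>)
  then have "box (0::real^'d) 1 homeomorphic ball (0::real^'d) 1"
    by (simp only: interior_cbox interior_cball)
  then show ?thesis
    unfolding homeomorphic_def homeomorphism_def homeomorphic_space_def homeomorphic_maps_def
    by (auto simp: image_subset_iff) blast
qed

theorem theorem1p4:
  assumes "CARD('n::finite) \<ge> 4"
    and "CARD('d::finite) = (CARD('n) - 1) choose 2"
  shows "rationally_equivalent (realizations 2 :: (real^('n+'n)^'n) set) (projective_equiv 2)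
           (interior (cbox (0::real^'d) 1)) \<and>
         (projective_realization_space 2 :: (real^('n+'n)^'n) set topology)
           homeomorphic_space top_of_set (ball (0::real^'d) 1) \<and>
         contractible_space (projective_realization_space 2 :: (real^('n+'n)^'n) set topology)"
proof (intro conjI)
  \<comment> \<open>Any index can be the distinguished vertex \<open>z\<close>;
    \<open>undefined\<close> merely names one.\<close>
  obtain a b where "pair_indexing (undefined :: 'n) a (b :: 'd \<Rightarrow> 'n)"
    using ex_pair_indexing[OF assms(2)] by blast
  then interpret pair_indexing "undefined :: 'n" a b .
  have "CARD('n) \<ge> 3"
    using assms(1) by simp
  then show rat: "rationally_equivalent (realizations 2 :: (real^('n+'n)^'n) set) (projective_equiv 2)
      (interior (cbox (0::real^'d) 1))"
    unfolding interior_cbox by (rule realizations_rationally_equivalent_box)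
  have "(projective_realization_space 2 :: (real^('n+'n)^'n) set topology)
      homeomorphic_space top_of_set (box (0::real^'d) 1)"
    using rat unfolding rationally_equivalent_def projective_realization_space_def homeomorphic_space_def
      interior_cbox by blast
  also have "top_of_set (box (0::real^'d) 1) homeomorphic_space top_of_set (ball (0::real^'d) 1)"
    by (rule box_homeomorphic_space_ball)
  finally show ball: "(projective_realization_space 2 :: (real^('n+'n)^'n) set topology)
      homeomorphic_space top_of_set (ball (0::real^'d) 1)" .
  have "contractible (ball (0::real^'d) 1)"
    by (intro convex_imp_contractible convex_ball)
  then show "contractible_space (projective_realization_space 2 :: (real^('n+'n)^'n) set topology)"
    using homeomorphic_space_contractibility[OF ball] by simp
qed

end
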